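(* Suppose $p=p_n$ satisfies $\frac{\log p_n}{n}\to\infty$ as $n\to\infty$. For each $n$ let $\mathbf{X}_1,\dots,\mathbf{X}_p$ be independent $n$-dimensional random vectors with a common spherical distribution (which may depend on $n$) satisfying $P(\mathbf{X}_1=\mathbf{0})=0$, and let $L_n=\max_{1\le i<j\le p}|\rho_{ij}|$, where $\rho_{ij}$ is the Pearson correlation coefficient of $\mathbf{X}_i$ and $\mathbf{X}_j$. Let $T_n=\log(1-L_n^2)$. Then: (i) $L_n\to1$ in probability as $n\to\infty$. Further, $\frac{n}{\log p}T_n\to-4$ in probability as $n\to\infty$. (ii) As $n\to\infty$, $$nT_n+\frac{4n}{n-2}\log p-\log n$$ converges weakly to the distribution with distribution function $F(y)=1-e^{-Ke^{y/2}}$, $y\in\mathbb{R}$, where $K=1/\sqrt{2\pi}$.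
   Context: A random vector $\mathbf{Y}\in\mathbb{R}^n$ has a spherical distribution if $\mathbf{O}\mathbf{Y}$ and $\mathbf{Y}$ have the same probability distribution for every $n\times n$ orthogonal matrix $\mathbf{O}$. For $\mathbf{x}=(x_1,\dots,x_n)^T$, $\mathbf{y}=(y_1,\dots,y_n)^T\in\mathbb{R}^n$, the Pearson correlation coefficient is $$\rho_{\mathbf{x},\mathbf{y}}=\frac{\sum_{i=1}^n(x_i-\bar x)(y_i-\bar y)}{\sqrt{\sum_{i=1}^n(x_i-\bar x)^2\cdot\sum_{i=1}^n(y_i-\bar y)^2}},\qquad \bar x=\frac1n\sum_{i=1}^n x_i,\quad \bar y=\frac1n\sum_{i=1}^n y_i,$$ and $\rho_{ij}=\rho_{\mathbf{X}_i,\mathbf{X}_j}$ (almost surely well defined for $n\ge2$). $\log$ is the natural logarithm, and $p=p_n$ is an integer depending on $n$ only. *)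

theory Defs
  imports "HOL-Probability.Probability"
begin

text \<open>
  The dimension \<open>n\<close> tends to infinity inside the statement, so a vector of $R^n$ is a function
  on the index set \<open>{1..n}\<close>, extended by \<open>undefined\<close> outside of it; matrices are functions of
  two indices of which only the entries with indices in \<open>{1..n}\<close> matter.
\<close>

definition Rn :: "nat \<Rightarrow> (nat \<Rightarrow> real) measure" where
  "Rn n = PiM {1..n} (\<lambda>_. borel)"

definition orthogonal_mat :: "nat \<Rightarrow> (nat \<Rightarrow> nat \<Rightarrow> real) \<Rightarrow> bool" where
  "orthogonal_mat n Q \<longleftrightarrow>
     (\<forall>i\<in>{1..n}. \<forall>j\<in>{1..n}.
        (\<Sum>k=1..n. Q k i * Q k j) = (if i = j then 1 else 0) \<and>
        (\<Sum>k=1..n. Q i k * Q j k) = (if i = j then 1 else 0))"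

definition mat_vec :: "nat \<Rightarrow> (nat \<Rightarrow> nat \<Rightarrow> real) \<Rightarrow> (nat \<Rightarrow> real) \<Rightarrow> (nat \<Rightarrow> real)" where
  "mat_vec n Q x = (\<lambda>i\<in>{1..n}. \<Sum>k=1..n. Q i k * x k)"

definition spherical :: "'a measure \<Rightarrow> nat \<Rightarrow> ('a \<Rightarrow> nat \<Rightarrow> real) \<Rightarrow> bool" where
  "spherical M n Y \<longleftrightarrow> Y \<in> measurable M (Rn n) \<and>
     (\<forall>Q. orthogonal_mat n Q \<longrightarrow> distr M (Rn n) (\<lambda>\<omega>. mat_vec n Q (Y \<omega>)) = distr M (Rn n) Y)"

definition mean :: "nat \<Rightarrow> (nat \<Rightarrow> real) \<Rightarrow> real" where
  "mean n x = (\<Sum>i=1..n. x i) / real n"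

definition pearson :: "nat \<Rightarrow> (nat \<Rightarrow> real) \<Rightarrow> (nat \<Rightarrow> real) \<Rightarrow> real" where
  "pearson n x y =
     (\<Sum>i=1..n. (x i - mean n x) * (y i - mean n y)) /
     sqrt ((\<Sum>i=1..n. (x i - mean n x)^2) * (\<Sum>i=1..n. (y i - mean n y)^2))"

text \<open>
  \<open>coherence n p x\<close> is only meaningful for \<open>p \<ge> 2\<close>; otherwise the maximum is over the empty set.
\<close>

definition coherence :: "nat \<Rightarrow> nat \<Rightarrow> (nat \<Rightarrow> nat \<Rightarrow> real) \<Rightarrow> real" where
  "coherence n p x = Max {\<bar>pearson n (x i) (x j)\<bar> | i j. 1 \<le> i \<and> i < j \<and> j \<le> p}"

text \<open>
  The random variable \<open>Y n\<close> lives on its own probability space \<open>M n\<close>. As \<^const>\<open>measure\<close> and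
  \<^const>\<open>distr\<close> are degenerate on non-measurable arguments, both modes of convergence below
  demand measurability, but only for large \<open>n\<close>.
\<close>

definition conv_in_prob :: "(nat \<Rightarrow> 'a measure) \<Rightarrow> (nat \<Rightarrow> 'a \<Rightarrow> real) \<Rightarrow> real \<Rightarrow> bool" where
  "conv_in_prob M Y c \<longleftrightarrow>
     (\<forall>\<^sub>F n in sequentially. Y n \<in> borel_measurable (M n)) \<and>
     (\<forall>\<epsilon>>0. (\<lambda>n. measure (M n) {\<omega> \<in> space (M n). \<bar>Y n \<omega> - c\<bar> > \<epsilon>}) \<longlonglongrightarrow> 0)"

definition conv_in_law :: "(nat \<Rightarrow> 'a measure) \<Rightarrow> (nat \<Rightarrow> 'a \<Rightarrow> real) \<Rightarrow> real measure \<Rightarrow> bool" where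
  "conv_in_law M Y N \<longleftrightarrow>
     (\<forall>\<^sub>F n in sequentially. Y n \<in> borel_measurable (M n)) \<and>
     weak_conv_m (\<lambda>n. distr (M n) borel (Y n)) N"

end

theory Submission
  imports Defs "HOL-Real_Asymp.Real_Asymp"
begin

text \<open>
  Centering a vector and normalising it turns a spherical law on \<open>R\<^sup>n\<close> without atom at 0 into the uniform law on
  the unit sphere of the hyperplane orthogonal to \<open>(1,...,1)\<close>, and \<open>\<rho>\<^sub>i\<^sub>j\<close> is the cosine of the
  angle between two such points. Two facts then decide the limit law.

  First, for a fixed point \<open>x\<close> the set of all \<open>y\<close> with \<open>\<rho>\<^sup>2 \<ge> 1 - \<delta>\<close> is a double cone around \<open>x\<close>,
  whose probability \<open>q\<close> depends neither on \<open>x\<close> nor on the spherical law. Independence of \<open>x\<close> holds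
  because reflections act transitively on directions (\<open>cone_measure_const\<close>); independence of the law
  holds by exchanging the order of integration over two invariant laws (\<open>cone_measure_ratio\<close>). So
  \<open>q\<close> may be computed for Lebesgue measure on the unit ball of dimension \<open>n - 1\<close>, as a quotient of
  volumes of a double cap and of the ball (\<open>cap_fraction_bounds\<close>). With
  \<open>ln \<delta> = (y + ln n) / n - 4 / (n - 2) * ln p\<close>, which tends to \<open>-\<infinity>\<close> because \<open>ln p / n \<rightarrow> \<infinity>\<close>,
  one gets \<open>p\<^sup>2 q \<rightarrow> 2 K exp (y / 2)\<close> (\<open>cap_fraction_threshold_asymp\<close>).

  Second, as \<open>q\<close> does not depend on the centre of the cone, the events \<open>\<rho>\<^sub>i\<^sub>j\<^sup>2 \<ge> 1 - \<delta>\<close> are pairwise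
  independent, even for pairs with a common index. Adding the sample points one at a time and
  applying Bonferroni's inequalities to the new point gives
  \<open>P(no close pair) = exp (- q p (p - 1) / 2) + O(p\<^sup>3 q\<^sup>2)\<close> (\<open>prob_no_related_pair\<close>); since \<open>p\<^sup>2 q\<close>
  stays bounded and \<open>p \<rightarrow> \<infinity>\<close>, the error vanishes. The event says that \<open>L\<^sup>2 < 1 - \<delta>\<close>, that
  is, that the normalised statistic exceeds \<open>y\<close>, so its limit \<open>exp (- K exp (y / 2))\<close> is \<open>1 - F y\<close>. The case \<open>\<delta> = 0\<close>, where \<open>q = 0\<close>,
  shows that \<open>L < 1\<close> almost surely, so that \<open>T\<close> is finite.

  Both statements of convergence in probability follow from the limit law: a family with a limit
  law is tight, \<open>T\<close> differs from \<open>-4 ln p / n\<close> by terms that are small compared with \<open>ln p / n\<close>, and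
  \<open>ln p / n \<rightarrow> \<infinity>\<close> forces \<open>T\<close> to \<open>-\<infinity>\<close>, that is, \<open>L\<close> to 1.
\<close>

section \<open>Reflections and reflection-invariant measures\<close>

definition inner_on :: "'i set \<Rightarrow> ('i \<Rightarrow> real) \<Rightarrow> ('i \<Rightarrow> real) \<Rightarrow> real" where
  "inner_on I x y = (\<Sum>i\<in>I. x i * y i)"

text \<open>
  The Householder reflection in the hyperplane orthogonal to \<open>w\<close>. Because of \<open>x / 0 = 0\<close> it is the
  identity on \<open>I\<close> when \<open>w\<close> vanishes there, so the isometry laws below hold for every \<open>w\<close>.
\<close>

definition reflect :: "'i set \<Rightarrow> ('i \<Rightarrow> real) \<Rightarrow> ('i \<Rightarrow> real) \<Rightarrow> 'i \<Rightarrow> real" where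
  "reflect I w x = (\<lambda>i\<in>I. x i - 2 * inner_on I w x / inner_on I w w * w i)"

lemma inner_on_commute: "inner_on I x y = inner_on I y x"
  by (simp add: inner_on_def mult.commute)

lemma inner_on_self_nonneg [simp]: "inner_on I x x \<ge> 0"
  by (simp add: inner_on_def sum_nonneg)

lemma inner_on_self_eq_0_iff:
  "finite I \<Longrightarrow> inner_on I x x = 0 \<longleftrightarrow> (\<forall>i\<in>I. x i = 0)"
  by (simp add: inner_on_def sum_nonneg_eq_0_iff)

lemma inner_on_self_pos_iff:
  "finite I \<Longrightarrow> inner_on I x x > 0 \<longleftrightarrow> (\<exists>i\<in>I. x i \<noteq> 0)"
  using inner_on_self_eq_0_iff[of I x] inner_on_self_nonneg[of I x] by (auto simp: less_le)

lemma inner_on_cong: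
  "(\<And>i. i \<in> I \<Longrightarrow> x i = x' i) \<Longrightarrow> (\<And>i. i \<in> I \<Longrightarrow> y i = y' i) \<Longrightarrow> inner_on I x y = inner_on I x' y'"
  by (simp add: inner_on_def)

lemma inner_on_Cauchy_Schwarz: "(inner_on I x y)\<^sup>2 \<le> inner_on I x x * inner_on I y y"
  using Cauchy_Schwarz_ineq_sum[of x y I] by (simp add: inner_on_def power2_eq_square)

lemma inner_on_restrict [simp]:
  "inner_on I (restrict x I) y = inner_on I x y" "inner_on I x (restrict y I) = inner_on I x y"
  by (simp_all add: inner_on_def)

lemma inner_on_diff_right: "inner_on I x (\<lambda>i. y i - z i) = inner_on I x y - inner_on I x z"
  by (simp add: inner_on_def algebra_simps sum_subtractf)

lemma inner_on_diff_left: "inner_on I (\<lambda>i. y i - z i) x = inner_on I y x - inner_on I z x"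
  by (simp add: inner_on_def algebra_simps sum_subtractf)

lemma inner_on_add_right: "inner_on I x (\<lambda>i. y i + z i) = inner_on I x y + inner_on I x z"
  by (simp add: inner_on_def algebra_simps sum.distrib)

lemma inner_on_scale_right: "inner_on I x (\<lambda>i. c * y i) = c * inner_on I x y"
  by (simp add: inner_on_def algebra_simps sum_distrib_left)

lemma inner_on_scale_left: "inner_on I (\<lambda>i. c * x i) y = c * inner_on I x y"
  by (simp add: inner_on_def algebra_simps sum_distrib_left)

lemma inner_on_reflect_right:
  "inner_on I y (reflect I w x) = inner_on I y x - 2 * inner_on I w x / inner_on I w w * inner_on I y w"
  by (simp add: reflect_def inner_on_diff_right inner_on_scale_right del: times_divide_eq_left)

lemma inner_on_reflect [simp]:
  "inner_on I (reflect I w x) (reflect I w y) = inner_on I x y"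
proof -
  have "inner_on I (reflect I w x) (reflect I w y) =
     inner_on I y (reflect I w x) - 2 * inner_on I w y / inner_on I w w * inner_on I w (reflect I w x)"
    using inner_on_reflect_right[of I "reflect I w x" w y]
    by (simp add: inner_on_commute[of I "reflect I w x" y] inner_on_commute[of I "reflect I w x" w])
  also have "\<dots> = inner_on I x y"
    by (simp add: inner_on_reflect_right inner_on_commute[of I x] inner_on_commute[of I y w] field_simps)
  finally show ?thesis .
qed

lemma reflect_reflect:
  assumes "finite I"
  shows "reflect I w (reflect I w x) = restrict x I"
proof (cases "inner_on I w w = 0")
  case True
  then show ?thesis by (simp add: reflect_def fun_eq_iff)
next
  case False
  then have "inner_on I w (reflect I w x) = - inner_on I w x"
    by (simp add: inner_on_reflect_right)
  then show ?thesis
    unfolding reflect_def[of I w "reflect I w x"] by (auto simp: reflect_def fun_eq_iff)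
qed

lemma reflect_add:
  "reflect I w (\<lambda>i\<in>I. x i + y i) = (\<lambda>i\<in>I. reflect I w x i + reflect I w y i)"
  by (auto simp: reflect_def fun_eq_iff inner_on_add_right add_divide_distrib algebra_simps)

lemma reflect_in_extensional [simp]: "reflect I w x \<in> extensional I"
  by (simp add: reflect_def)

text \<open>
  Two vectors of equal length are exchanged by the reflection along their difference. This is the
  source of all transitivity arguments: no orthogonal map other than a reflection is ever used.
\<close>

lemma reflect_exchange:
  assumes "finite I" and eq: "inner_on I x x = inner_on I y y"
  shows "reflect I (\<lambda>i. x i - y i) x = restrict y I"
proof -
  let ?w = "\<lambda>i. x i - y i"
  have s: "inner_on I ?w ?w = 2 * inner_on I ?w x"
    using eq by (simp add: inner_on_diff_right inner_on_diff_left inner_on_commute[of I y x])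
  show ?thesis
  proof (cases "inner_on I ?w ?w = 0")
    case True
    then have "\<forall>i\<in>I. x i = y i" using inner_on_self_eq_0_iff[OF assms(1), of ?w] by simp
    then show ?thesis using True by (auto simp: reflect_def fun_eq_iff)
  next
    case False
    then have "2 * inner_on I ?w x / inner_on I ?w ?w = 1" using s by simp
    then show ?thesis unfolding reflect_def by (auto simp: fun_eq_iff)
  qed
qed

lemma measurable_inner_on [measurable (raw)]:
  assumes "\<And>i. i \<in> I \<Longrightarrow> (\<lambda>\<omega>. f \<omega> i) \<in> borel_measurable N"
    and "\<And>i. i \<in> I \<Longrightarrow> (\<lambda>\<omega>. g \<omega> i) \<in> borel_measurable N"
  shows "(\<lambda>\<omega>. inner_on I (f \<omega>) (g \<omega>)) \<in> borel_measurable N"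
  unfolding inner_on_def using assms by measurable

lemma measurable_reflect [measurable]:
  "reflect I w \<in> measurable (PiM I (\<lambda>_. borel)) (PiM I (\<lambda>_. borel))"
  unfolding reflect_def by measurable

text \<open>
  The solid double cone of all \<open>y\<close> whose squared cosine with \<open>x\<close> is at least \<open>s\<close>, written without
  division. The apex \<open>y = 0\<close> belongs to it, as does every \<open>y\<close> if \<open>x = 0\<close>.
\<close>

definition in_cone :: "'i set \<Rightarrow> real \<Rightarrow> ('i \<Rightarrow> real) \<Rightarrow> ('i \<Rightarrow> real) \<Rightarrow> bool" where
  "in_cone I s x y \<longleftrightarrow> s * (inner_on I x x * inner_on I y y) \<le> (inner_on I x y)\<^sup>2"

lemma in_cone_commute: "in_cone I s x y \<longleftrightarrow> in_cone I s y x"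
  by (simp add: in_cone_def mult.commute inner_on_commute)

lemma in_cone_scale:
  assumes "c \<noteq> 0"
  shows "in_cone I s (\<lambda>i. c * x i) y \<longleftrightarrow> in_cone I s x y"
proof -
  have "in_cone I s (\<lambda>i. c * x i) y \<longleftrightarrow>
      c\<^sup>2 * (s * (inner_on I x x * inner_on I y y)) \<le> c\<^sup>2 * (inner_on I x y)\<^sup>2"
    by (simp add: in_cone_def inner_on_scale_left inner_on_scale_right power_mult_distrib
        power2_eq_square mult_ac)
  then show ?thesis using assms by (simp add: in_cone_def)
qed

text \<open>
  A cone depends on the direction of its axis only, so the two axes may be scaled to the same
  length; then one reflection carries the first cone to the second.
\<close>

lemma in_cone_transport:
  assumes fin: "finite I" and "inner_on I x x > 0" "inner_on I x' x' > 0"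
  shows "\<exists>w. \<forall>y. in_cone I s x' (reflect I w y) \<longleftrightarrow> in_cone I s x y"
proof -
  define c where "c = sqrt (inner_on I x x / inner_on I x' x')"
  have c: "c > 0" "c\<^sup>2 = inner_on I x x / inner_on I x' x'"
    using assms by (simp_all add: c_def)
  define z where "z = (\<lambda>i. c * x' i)"
  have "inner_on I z z = c\<^sup>2 * inner_on I x' x'"
    by (simp add: z_def inner_on_scale_left inner_on_scale_right power2_eq_square)
  then have "inner_on I x x = inner_on I z z" using c assms by simp
  from reflect_exchange[OF fin this]
  have r: "reflect I (\<lambda>i. x i - z i) x = restrict z I" .
  let ?w = "\<lambda>i. x i - z i"
  have "in_cone I s x' (reflect I ?w y) \<longleftrightarrow> in_cone I s x y" for y
  proof -
    have "in_cone I s x' (reflect I ?w y) \<longleftrightarrow> in_cone I s z (reflect I ?w y)"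
      unfolding z_def using in_cone_scale[of c I s x'] c by simp
    also have "\<dots> \<longleftrightarrow> in_cone I s (restrict z I) (reflect I ?w y)"
      by (simp add: in_cone_def)
    also have "\<dots> \<longleftrightarrow> in_cone I s x y"
      unfolding r[symmetric] by (simp add: in_cone_def)
    finally show ?thesis .
  qed
  then show ?thesis by blast
qed

text \<open>
  Reflections generate the orthogonal group, so this is sphericity of a measure, in a form that makes
  sense for measures of any total mass.
\<close>

definition reflection_invariant :: "'i set \<Rightarrow> ('i \<Rightarrow> real) measure \<Rightarrow> bool" where
  "reflection_invariant I \<nu> \<longleftrightarrow> sets \<nu> = sets (PiM I (\<lambda>_. borel)) \<and>
     (\<forall>w. distr \<nu> (PiM I (\<lambda>_. borel)) (reflect I w) = \<nu>)"

lemma cone_measure_const: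
  assumes fin: "finite I" and inv: "reflection_invariant I \<nu>"
    and x: "inner_on I x x > 0" "inner_on I x' x' > 0"
  shows "emeasure \<nu> {y \<in> space \<nu>. in_cone I s x y} = emeasure \<nu> {y \<in> space \<nu>. in_cone I s x' y}"
proof -
  let ?P = "PiM I (\<lambda>_. borel) :: ('a \<Rightarrow> real) measure"
  have sets: "sets \<nu> = sets ?P" and sp: "space \<nu> = space ?P"
    using inv sets_eq_imp_space_eq by (auto simp: reflection_invariant_def)
  obtain w where w: "\<And>y. in_cone I s x' (reflect I w y) \<longleftrightarrow> in_cone I s x y"
    using in_cone_transport[OF fin x] by blast
  have [measurable]: "reflect I w \<in> measurable \<nu> ?P"
    using measurable_reflect[of I w] by (simp add: measurable_cong_sets[OF sets refl])
  have "emeasure \<nu> {y \<in> space \<nu>. in_cone I s x' y} =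
        emeasure (distr \<nu> ?P (reflect I w)) {y \<in> space ?P. in_cone I s x' y}"
    using inv sp by (simp add: reflection_invariant_def)
  also have "\<dots> = emeasure \<nu> (reflect I w -` {y \<in> space ?P. in_cone I s x' y} \<inter> space \<nu>)"
    by (rule emeasure_distr) (unfold in_cone_def, measurable)
  also have "reflect I w -` {y \<in> space ?P. in_cone I s x' y} \<inter> space \<nu> = {y \<in> space \<nu>. in_cone I s x y}"
    using w by (auto simp: space_PiM PiE_def)
  finally show ?thesis by simp
qed

text \<open>
  Integrate the symmetric relation "\<open>y\<close> lies in the cone around \<open>x\<close>" over \<open>\<mu> \<times> \<nu>\<close>. Integrating out
  \<open>y\<close> first leaves the constant \<open>\<nu>\<close>-measure of a cone, integrating out \<open>x\<close> first leaves the constant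
  \<open>\<mu>\<close>-measure of a cone. Hence all spherical laws without an atom at the origin give the same
  probability to a cone.
\<close>

lemma cone_measure_ratio:
  assumes fin: "finite I" and "reflection_invariant I \<mu>" "reflection_invariant I \<nu>"
    and "finite_measure \<mu>" "finite_measure \<nu>"
    and "emeasure \<mu> {y \<in> space \<mu>. inner_on I y y = 0} = 0"
    and "emeasure \<nu> {y \<in> space \<nu>. inner_on I y y = 0} = 0"
    and e: "inner_on I e e > 0"
  shows "emeasure \<mu> {y \<in> space \<mu>. in_cone I s e y} * emeasure \<nu> (space \<nu>) =
         emeasure \<nu> {y \<in> space \<nu>. in_cone I s e y} * emeasure \<mu> (space \<mu>)"
proof -
  interpret m: finite_measure \<mu> by fact
  interpret n: finite_measure \<nu> by fact
  interpret pair_sigma_finite \<mu> \<nu> ..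
  let ?P = "PiM I (\<lambda>_. borel) :: ('a \<Rightarrow> real) measure"
  have [measurable_cong]: "sets \<mu> = sets ?P" "sets \<nu> = sets ?P"
    using assms by (auto simp: reflection_invariant_def)
  have m1: "AE x in \<mu>. inner_on I x x > 0"
    by (rule AE_I[OF _ assms(6)]) (auto simp: less_le)
  have n1: "AE x in \<nu>. inner_on I x x > 0"
    by (rule AE_I[OF _ assms(7)]) (auto simp: less_le)
  have meas: "(\<lambda>(x, y). indicator {y. in_cone I s x y} y :: ennreal) \<in> borel_measurable (\<mu> \<Otimes>\<^sub>M \<nu>)"
    unfolding in_cone_def indicator_def mem_Collect_eq by measurable
  have "emeasure \<nu> {y \<in> space \<nu>. in_cone I s e y} * emeasure \<mu> (space \<mu>) =
        (\<integral>\<^sup>+ x. emeasure \<nu> {y \<in> space \<nu>. in_cone I s e y} \<partial>\<mu>)" by simp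
  also have "\<dots> = (\<integral>\<^sup>+ x. \<integral>\<^sup>+ y. indicator {y. in_cone I s x y} y \<partial>\<nu> \<partial>\<mu>)"
  proof (rule nn_integral_cong_AE, use m1 in eventually_elim)
    case (elim x)
    have "(\<integral>\<^sup>+ y. indicator {y. in_cone I s x y} y \<partial>\<nu>) =
          (\<integral>\<^sup>+ y. indicator {y \<in> space \<nu>. in_cone I s x y} y \<partial>\<nu>)"
      by (rule nn_integral_cong) (simp add: indicator_def)
    also have "\<dots> = emeasure \<nu> {y \<in> space \<nu>. in_cone I s x y}"
      by (rule nn_integral_indicator) (unfold in_cone_def, measurable)
    finally show ?case using cone_measure_const[OF fin assms(3) elim e, of s] by simp
  qed
  also have "\<dots> = (\<integral>\<^sup>+ y. \<integral>\<^sup>+ x. indicator {y. in_cone I s x y} y \<partial>\<mu> \<partial>\<nu>)"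
    by (rule Fubini'[OF meas, symmetric])
  also have "\<dots> = (\<integral>\<^sup>+ y. emeasure \<mu> {y \<in> space \<mu>. in_cone I s e y} \<partial>\<nu>)"
  proof (rule nn_integral_cong_AE, use n1 in eventually_elim)
    case (elim y)
    have "(\<integral>\<^sup>+ x. indicator {y. in_cone I s x y} y \<partial>\<mu>) =
          (\<integral>\<^sup>+ x. indicator {x \<in> space \<mu>. in_cone I s y x} x \<partial>\<mu>)"
      by (rule nn_integral_cong) (auto simp: indicator_def in_cone_commute[of I s y])
    also have "\<dots> = emeasure \<mu> {x \<in> space \<mu>. in_cone I s y x}"
      by (rule nn_integral_indicator) (unfold in_cone_def, measurable)
    finally show ?case using cone_measure_const[OF fin assms(2) elim e, of s] by simp
  qed
  also have "\<dots> = emeasure \<mu> {y \<in> space \<mu>. in_cone I s e y} * emeasure \<nu> (space \<nu>)" by simp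
  finally show ?thesis by simp
qed

section \<open>Lebesgue measure on a finite product is reflection-invariant\<close>

lemma lborel_PiM_translation:
  assumes fin: "finite I"
  shows "distr (PiM I (\<lambda>_. lborel)) (PiM I (\<lambda>_. lborel)) (\<lambda>x. \<lambda>i\<in>I. x i + a i) =
         (PiM I (\<lambda>_. lborel) :: ('i \<Rightarrow> real) measure)"
proof -
  interpret product_sigma_finite "\<lambda>_::'i. lborel :: real measure" by standard
  let ?P = "PiM I (\<lambda>_. lborel) :: ('i \<Rightarrow> real) measure"
  show ?thesis
  proof (rule PiM_eqI[OF fin])
    fix A :: "'i \<Rightarrow> real set"
    assume A: "\<And>i. i \<in> I \<Longrightarrow> A i \<in> sets lborel"
    have t: "emeasure lborel ((\<lambda>y. y + a i) -` A i) = emeasure lborel (A i)" if "i \<in> I" for i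
    proof -
      have "emeasure lborel (A i) = emeasure (distr lborel borel ((+) (a i))) (A i)"
        by (simp add: lborel_distr_plus)
      also have "\<dots> = emeasure lborel ((\<lambda>y. y + a i) -` A i)"
        using A[OF that] by (subst emeasure_distr) (auto simp: add.commute vimage_def)
      finally show ?thesis by simp
    qed
    have m: "(\<lambda>y. y + a i) -` A i \<in> sets lborel" if "i \<in> I" for i
      using measurable_sets[of "\<lambda>y. y + a i" borel borel "A i"] A[OF that] by simp
    have "emeasure (distr ?P ?P (\<lambda>x. \<lambda>i\<in>I. x i + a i)) (Pi\<^sub>E I A) =
        emeasure ?P ((\<lambda>x. \<lambda>i\<in>I. x i + a i) -` Pi\<^sub>E I A \<inter> space ?P)"
      using A fin by (intro emeasure_distr sets_PiM_I_finite) auto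
    also have "(\<lambda>x. \<lambda>i\<in>I. x i + a i) -` Pi\<^sub>E I A \<inter> space ?P = (\<Pi>\<^sub>E i\<in>I. (\<lambda>y. y + a i) -` A i)"
      by (auto simp: space_PiM PiE_iff)
    also have "emeasure ?P \<dots> = (\<Prod>i\<in>I. emeasure lborel ((\<lambda>y. y + a i) -` A i))"
      using m by (intro emeasure_PiM fin) auto
    also have "\<dots> = (\<Prod>i\<in>I. emeasure lborel (A i))"
      by (intro prod.cong refl t)
    finally show "emeasure (distr ?P ?P (\<lambda>x. \<lambda>i\<in>I. x i + a i)) (Pi\<^sub>E I A) =
        (\<Prod>i\<in>I. emeasure lborel (A i))" .
  qed simp
qed

lemma nn_integral_lborel_PiM_translation:
  fixes f :: "('i \<Rightarrow> real) \<Rightarrow> ennreal"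
  assumes fin: "finite I" and f: "f \<in> borel_measurable (PiM I (\<lambda>_. lborel))"
  shows "(\<integral>\<^sup>+ x. f (\<lambda>i\<in>I. x i + a i) \<partial>PiM I (\<lambda>_. lborel)) = (\<integral>\<^sup>+ x. f x \<partial>PiM I (\<lambda>_. lborel))"
proof -
  let ?P = "PiM I (\<lambda>_. lborel) :: ('i \<Rightarrow> real) measure"
  have "(\<integral>\<^sup>+ x. f x \<partial>?P) = (\<integral>\<^sup>+ x. f x \<partial>distr ?P ?P (\<lambda>x. \<lambda>i\<in>I. x i + a i))"
    by (simp only: lborel_PiM_translation[OF fin])
  also have "\<dots> = (\<integral>\<^sup>+ x. f (\<lambda>i\<in>I. x i + a i) \<partial>?P)"
    by (rule nn_integral_distr) (use f in measurable)
  finally show ?thesis by simp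
qed

definition unit_ball_on :: "'i set \<Rightarrow> ('i \<Rightarrow> real) set" where
  "unit_ball_on I = {x. inner_on I x x \<le> 1}"

lemma sets_PiM_lborel: "sets (PiM I (\<lambda>_. lborel)) = sets (PiM I (\<lambda>_. borel))"
  by (rule sets_PiM_cong) auto

lemma emeasure_unit_ball_on:
  assumes "finite I"
  shows "emeasure (PiM I (\<lambda>_. lborel)) (unit_ball_on I \<inter> space (PiM I (\<lambda>_. lborel))) =
         ennreal (unit_ball_vol (real (card I)))"
  using emeasure_cball_aux[OF assms, of 1]
  by (simp add: unit_ball_on_def inner_on_def power2_eq_square)

text \<open>
  The argument is the one for uniqueness of Haar measure. With \<open>g\<close> the indicator function of the unit
  ball and \<open>H\<close> the reflection, evaluate \<open>\<integral>\<integral> g(y) f(y + H x) dx dy\<close> in two ways. The substitution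
  \<open>x := x + H y\<close> shows that it equals \<open>\<integral> g * \<integral> f(H x) dx\<close>; the substitution \<open>y := y - H x\<close> together
  with \<open>g(y - H x) = g(x - H y)\<close> shows that it equals \<open>\<integral> g * \<integral> f\<close>. The volume of the ball is finite and
  positive, so it cancels.
\<close>

lemma nn_integral_lborel_PiM_reflect:
  fixes f :: "('i \<Rightarrow> real) \<Rightarrow> ennreal"
  assumes fin: "finite I" and f[measurable]: "f \<in> borel_measurable (PiM I (\<lambda>_. borel))"
  shows "(\<integral>\<^sup>+ x. f (reflect I w x) \<partial>PiM I (\<lambda>_. lborel)) = (\<integral>\<^sup>+ x. f x \<partial>PiM I (\<lambda>_. lborel))"
proof -
  interpret product_sigma_finite "\<lambda>_::'i. lborel :: real measure" by standard
  let ?P = "PiM I (\<lambda>_. lborel) :: ('i \<Rightarrow> real) measure"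
  interpret P: sigma_finite_measure ?P by (rule sigma_finite[OF fin])
  interpret pair_sigma_finite ?P ?P ..
  let ?H = "reflect I w"
  have [measurable_cong]: "sets ?P = sets (PiM I (\<lambda>_. borel))" by (rule sets_PiM_lborel)
  define g where "g = (indicator (unit_ball_on I) :: ('i \<Rightarrow> real) \<Rightarrow> ennreal)"
  have [measurable]: "g \<in> borel_measurable (PiM I (\<lambda>_. borel))"
    unfolding g_def unit_ball_on_def indicator_def mem_Collect_eq by measurable
  define c where "c = (\<integral>\<^sup>+ x. g x \<partial>?P)"
  have c: "c = ennreal (unit_ball_vol (real (card I)))"
  proof -
    have "c = (\<integral>\<^sup>+ x. indicator (unit_ball_on I \<inter> space ?P) x \<partial>?P)"
      unfolding c_def g_def by (rule nn_integral_cong) (simp add: indicator_def)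
    also have "\<dots> = emeasure ?P (unit_ball_on I \<inter> space ?P)"
    proof (rule nn_integral_indicator)
      have "unit_ball_on I \<inter> space ?P = {x \<in> space ?P. inner_on I x x \<le> 1}"
        by (auto simp: unit_ball_on_def)
      also have "\<dots> \<in> sets ?P" by measurable
      finally show "unit_ball_on I \<inter> space ?P \<in> sets ?P" .
    qed
    finally show ?thesis using emeasure_unit_ball_on[OF fin] by simp
  qed
  have sub: "(\<integral>\<^sup>+ x. h x \<partial>?P) = (\<integral>\<^sup>+ x. h (\<lambda>i\<in>I. x i + a i) \<partial>?P)"
    if "h \<in> borel_measurable (PiM I (\<lambda>_. borel))" for h :: "('i \<Rightarrow> real) \<Rightarrow> ennreal" and a
  proof (rule nn_integral_lborel_PiM_translation[OF fin, symmetric])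
    show "h \<in> borel_measurable ?P" using that by measurable
  qed
  have "c * (\<integral>\<^sup>+ x. f (?H x) \<partial>?P) = (\<integral>\<^sup>+ y. g y * (\<integral>\<^sup>+ x. f (?H x) \<partial>?P) \<partial>?P)"
    unfolding c_def by (rule nn_integral_multc[symmetric]) measurable
  also have "\<dots> = (\<integral>\<^sup>+ y. (\<integral>\<^sup>+ x. g y * f (\<lambda>i\<in>I. y i + ?H x i) \<partial>?P) \<partial>?P)"
  proof (rule nn_integral_cong)
    fix y assume y: "y \<in> space ?P"
    have "(\<integral>\<^sup>+ x. f (?H x) \<partial>?P) = (\<integral>\<^sup>+ x. f (?H (\<lambda>i\<in>I. x i + ?H y i)) \<partial>?P)"
      by (rule sub) measurable
    also have "\<dots> = (\<integral>\<^sup>+ x. f (\<lambda>i\<in>I. y i + ?H x i) \<partial>?P)"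
      by (rule nn_integral_cong, rule arg_cong[where f = f])
        (auto simp: reflect_add reflect_reflect[OF fin] fun_eq_iff)
    finally show "g y * (\<integral>\<^sup>+ x. f (?H x) \<partial>?P) = (\<integral>\<^sup>+ x. g y * f (\<lambda>i\<in>I. y i + ?H x i) \<partial>?P)"
      by (simp, intro nn_integral_cmult[symmetric]) measurable
  qed
  also have "\<dots> = (\<integral>\<^sup>+ x. (\<integral>\<^sup>+ y. g y * f (\<lambda>i\<in>I. y i + ?H x i) \<partial>?P) \<partial>?P)"
    by (rule Fubini'[symmetric]) measurable
  also have "\<dots> = (\<integral>\<^sup>+ x. (\<integral>\<^sup>+ y. g (\<lambda>i\<in>I. y i - ?H x i) * f y \<partial>?P) \<partial>?P)"
  proof (rule nn_integral_cong)
    fix x assume x: "x \<in> space ?P"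
    have "(\<integral>\<^sup>+ y. g (\<lambda>i\<in>I. y i - ?H x i) * f y \<partial>?P) =
      (\<integral>\<^sup>+ y. g (\<lambda>i\<in>I. (\<lambda>i\<in>I. y i + ?H x i) i - ?H x i) * f (\<lambda>i\<in>I. y i + ?H x i) \<partial>?P)"
      by (rule sub) measurable
    also have "\<dots> = (\<integral>\<^sup>+ y. g y * f (\<lambda>i\<in>I. y i + ?H x i) \<partial>?P)"
    proof (rule nn_integral_cong)
      fix y assume "y \<in> space ?P"
      then have "(\<lambda>i\<in>I. (\<lambda>i\<in>I. y i + ?H x i) i - ?H x i) = y"
        by (auto simp: space_PiM PiE_iff extensional_def fun_eq_iff)
      then show "g (\<lambda>i\<in>I. (\<lambda>i\<in>I. y i + ?H x i) i - ?H x i) * f (\<lambda>i\<in>I. y i + ?H x i) =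
          g y * f (\<lambda>i\<in>I. y i + ?H x i)" by simp
    qed
    finally show "(\<integral>\<^sup>+ y. g y * f (\<lambda>i\<in>I. y i + ?H x i) \<partial>?P) =
        (\<integral>\<^sup>+ y. g (\<lambda>i\<in>I. y i - ?H x i) * f y \<partial>?P)" by simp
  qed
  also have "\<dots> = (\<integral>\<^sup>+ y. (\<integral>\<^sup>+ x. g (\<lambda>i\<in>I. y i - ?H x i) * f y \<partial>?P) \<partial>?P)"
    by (rule Fubini') measurable
  also have "\<dots> = (\<integral>\<^sup>+ y. c * f y \<partial>?P)"
  proof (rule nn_integral_cong)
    fix y assume y: "y \<in> space ?P"
    have "g (\<lambda>i\<in>I. y i - ?H x i) = g (\<lambda>i\<in>I. x i - ?H y i)" for x
    proof -
      have *: "inner_on I (\<lambda>i. y i - ?H x i) (\<lambda>i. y i - ?H x i) =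
            inner_on I (\<lambda>i. x i - ?H y i) (\<lambda>i. x i - ?H y i)"
        using inner_on_reflect[of I w y "reflect I w x"] 
        by (simp add: inner_on_diff_left inner_on_diff_right reflect_reflect[OF fin]
            inner_on_commute[of I "?H x" y] inner_on_commute[of I "?H y" x])
      then show ?thesis by (simp add: g_def indicator_def unit_ball_on_def)
    qed
    then have "(\<integral>\<^sup>+ x. g (\<lambda>i\<in>I. y i - ?H x i) * f y \<partial>?P) = (\<integral>\<^sup>+ x. g (\<lambda>i\<in>I. x i - ?H y i) * f y \<partial>?P)"
      by simp
    also have "\<dots> = (\<integral>\<^sup>+ x. g (\<lambda>i\<in>I. x i + - ?H y i) \<partial>?P) * f y"
      by (simp, rule nn_integral_multc) measurable
    also have "(\<integral>\<^sup>+ x. g (\<lambda>i\<in>I. x i + - ?H y i) \<partial>?P) = c"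
      unfolding c_def by (rule sub[symmetric]) measurable
    finally show "(\<integral>\<^sup>+ x. g (\<lambda>i\<in>I. y i - ?H x i) * f y \<partial>?P) = c * f y" .
  qed
  also have "\<dots> = c * (\<integral>\<^sup>+ y. f y \<partial>?P)"
    by (rule nn_integral_cmult) measurable
  finally have "c * (\<integral>\<^sup>+ x. f (?H x) \<partial>?P) = c * (\<integral>\<^sup>+ y. f y \<partial>?P)" .
  then show ?thesis
    using unit_ball_vol_pos[of "real (card I)", THEN less_imp_neq]
    by (subst (asm) ennreal_mult_cancel_left) (auto simp: c dest: sym)
qed

text \<open>
  Lebesgue measure on the unit ball: the spherical law for which cones are easiest to measure. It is
  left unnormalised, as only quotients matter.
\<close>

definition ball_measure :: "'i set \<Rightarrow> ('i \<Rightarrow> real) measure" where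
  "ball_measure I = density (PiM I (\<lambda>_. lborel)) (indicator (unit_ball_on I))"

lemma sets_ball_measure [measurable_cong]: "sets (ball_measure I) = sets (PiM I (\<lambda>_. borel))"
  by (simp add: ball_measure_def sets_PiM_lborel)

lemma emeasure_ball_measure:
  assumes "A \<in> sets (PiM I (\<lambda>_. borel))"
  shows "emeasure (ball_measure I) A = emeasure (PiM I (\<lambda>_. lborel)) (A \<inter> unit_ball_on I)"
    and "A \<inter> unit_ball_on I \<in> sets (PiM I (\<lambda>_. borel))"
proof -
  let ?P = "PiM I (\<lambda>_. lborel) :: ('a \<Rightarrow> real) measure"
  have [measurable_cong]: "sets ?P = sets (PiM I (\<lambda>_. borel))" by (rule sets_PiM_lborel)
  have [measurable]: "(indicator (unit_ball_on I) :: _ \<Rightarrow> ennreal) \<in> borel_measurable ?P"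
    unfolding unit_ball_on_def indicator_def mem_Collect_eq by measurable
  have A[measurable]: "A \<in> sets (PiM I (\<lambda>_. borel))" by fact
  have sp: "A \<subseteq> space ?P" using A sets.sets_into_space sets_PiM_lborel by metis
  have "A \<inter> unit_ball_on I = A \<inter> {x \<in> space ?P. inner_on I x x \<le> 1}"
    using sp by (auto simp: unit_ball_on_def)
  also have "\<dots> \<in> sets ?P" by measurable
  finally have m: "A \<inter> unit_ball_on I \<in> sets ?P" .
  then show "A \<inter> unit_ball_on I \<in> sets (PiM I (\<lambda>_. borel))" by (simp add: sets_PiM_lborel)
  have "emeasure (ball_measure I) A = (\<integral>\<^sup>+ x. indicator (unit_ball_on I) x * indicator A x \<partial>?P)"
    unfolding ball_measure_def by (rule emeasure_density) measurable
  also have "\<dots> = (\<integral>\<^sup>+ x. indicator (A \<inter> unit_ball_on I) x \<partial>?P)"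
    by (rule nn_integral_cong) (auto simp: indicator_def)
  also have "\<dots> = emeasure ?P (A \<inter> unit_ball_on I)"
    using m by simp
  finally show "emeasure (ball_measure I) A = emeasure ?P (A \<inter> unit_ball_on I)" .
qed

lemma ball_measure_space:
  assumes "finite I"
  shows "emeasure (ball_measure I) (space (ball_measure I)) = ennreal (unit_ball_vol (real (card I)))"
proof -
  have s: "space (ball_measure I) = space (PiM I (\<lambda>_. borel))"
    by (rule sets_eq_imp_space_eq[OF sets_ball_measure])
  then have s': "space (ball_measure I) = space (PiM I (\<lambda>_. lborel))"
    by (simp add: space_PiM)
  show ?thesis
    using emeasure_unit_ball_on[OF assms] emeasure_ball_measure(1)[of "space (ball_measure I)" I] s
    by (simp add: s' Int_commute)
qed

lemma ball_measure_reflection_invariant: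
  assumes fin: "finite I"
  shows "reflection_invariant I (ball_measure I)"
  unfolding reflection_invariant_def
proof (intro conjI allI sets_ball_measure)
  fix w
  let ?B = "PiM I (\<lambda>_. borel) :: ('a \<Rightarrow> real) measure"
  let ?P = "PiM I (\<lambda>_. lborel) :: ('a \<Rightarrow> real) measure"
  have [measurable_cong]: "sets ?P = sets (PiM I (\<lambda>_. borel))" by (rule sets_PiM_lborel)
  show "distr (ball_measure I) ?B (reflect I w) = ball_measure I"
  proof (rule measure_eqI)
    show "sets (distr (ball_measure I) ?B (reflect I w)) = sets (ball_measure I)"
      by (simp add: sets_ball_measure)
  next
    fix A assume "A \<in> sets (distr (ball_measure I) ?B (reflect I w))"
    then have A[measurable]: "A \<in> sets ?B" by simp
    let ?C = "reflect I w -` A \<inter> space ?B"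
    have C[measurable]: "?C \<in> sets ?B" by measurable
    have [measurable]: "A \<inter> unit_ball_on I \<in> sets ?B" "?C \<inter> unit_ball_on I \<in> sets ?B"
      using emeasure_ball_measure(2) A C by blast+
    have A': "A \<inter> unit_ball_on I \<in> sets ?P"
      using emeasure_ball_measure(2)[OF A] by (simp add: sets_PiM_lborel)
    have C': "?C \<inter> unit_ball_on I \<in> sets ?P"
      using emeasure_ball_measure(2)[OF C] by (simp add: sets_PiM_lborel)
    have "emeasure (distr (ball_measure I) ?B (reflect I w)) A = emeasure (ball_measure I) ?C"
      using sets_eq_imp_space_eq[OF sets_ball_measure[of I]]
      by (subst emeasure_distr) auto
    also have "\<dots> = emeasure ?P (?C \<inter> unit_ball_on I)"
      by (rule emeasure_ball_measure) fact
    also have "\<dots> = (\<integral>\<^sup>+ x. indicator (?C \<inter> unit_ball_on I) x \<partial>?P)"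
      by (rule nn_integral_indicator[symmetric]) (rule C')
    also have "\<dots> = (\<integral>\<^sup>+ x. indicator (A \<inter> unit_ball_on I) (reflect I w x) \<partial>?P)"
      by (rule nn_integral_cong) (auto simp: indicator_def unit_ball_on_def space_PiM)
    also have "\<dots> = (\<integral>\<^sup>+ x. indicator (A \<inter> unit_ball_on I) x \<partial>?P)"
      by (rule nn_integral_lborel_PiM_reflect[OF fin]) measurable
    also have "\<dots> = emeasure ?P (A \<inter> unit_ball_on I)"
      by (rule nn_integral_indicator) (rule A')
    also have "\<dots> = emeasure (ball_measure I) A"
      by (rule emeasure_ball_measure(1)[symmetric]) fact
    finally show "emeasure (distr (ball_measure I) ?B (reflect I w)) A = emeasure (ball_measure I) A" .
  qed
qed

section \<open>The volume of a double cap of the unit ball\<close>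

lemma nn_integral_even:
  fixes f :: "real \<Rightarrow> ennreal"
  assumes [measurable]: "f \<in> borel_measurable borel" and even: "\<And>x. f (- x) = f x"
  shows "(\<integral>\<^sup>+ x. f x \<partial>lborel) = 2 * (\<integral>\<^sup>+ x. f x * indicator {0..} x \<partial>lborel)"
proof -
  have "(\<integral>\<^sup>+ x. f x \<partial>lborel) = (\<integral>\<^sup>+ x. f x * indicator {0..} x + f x * indicator {..0} x \<partial>lborel)"
  proof (rule nn_integral_cong_AE)
    show "AE x in lborel. f x = f x * indicator {0..} x + f x * indicator {..0} x"
      using AE_lborel_singleton[of "0::real"]
      by eventually_elim (auto simp: indicator_def)
  qed
  also have "\<dots> = (\<integral>\<^sup>+ x. f x * indicator {0..} x \<partial>lborel) + (\<integral>\<^sup>+ x. f x * indicator {..0} x \<partial>lborel)"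
    by (rule nn_integral_add) measurable
  also have "(\<integral>\<^sup>+ x. f x * indicator {..0} x \<partial>lborel) =
      ennreal \<bar>-1\<bar> * (\<integral>\<^sup>+ x. f (0 + (-1) * x) * indicator {..0} (0 + (-1) * x) \<partial>lborel)"
  proof (rule nn_integral_real_affine)
    show "(\<lambda>x. f x * indicator {..0} x) \<in> borel_measurable borel" by simp
  qed simp
  also have "\<dots> = (\<integral>\<^sup>+ x. f x * indicator {0..} x \<partial>lborel)"
    by (auto simp: even indicator_def intro!: nn_integral_cong)
  finally show ?thesis by (simp add: mult_2)
qed

text \<open>
  The section at height \<open>z\<close> of the part of the unit ball in the double cone around the last axis is a
  ball with this radius. The cone gives the bound for small heights, the sphere for large ones; they
  meet at \<open>z\<^sup>2 = 1 - \<delta>\<close>.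
\<close>

definition cap_radius :: "real \<Rightarrow> real \<Rightarrow> real" where
  "cap_radius \<delta> z = min (sqrt (\<delta> / (1 - \<delta>)) * \<bar>z\<bar>) (sqrt (1 - z\<^sup>2))"

lemma cap_section:
  fixes \<delta> z a :: real
  assumes d: "0 \<le> \<delta>" "\<delta> < 1" and z: "\<bar>z\<bar> \<le> 1" and a: "a \<ge> 0"
  shows "(1 - \<delta>) * (a + z\<^sup>2) \<le> z\<^sup>2 \<and> a + z\<^sup>2 \<le> 1 \<longleftrightarrow> sqrt a \<le> cap_radius \<delta> z"
proof -
  have "(1 - \<delta>) * (a + z\<^sup>2) \<le> z\<^sup>2 \<longleftrightarrow> a \<le> \<delta> / (1 - \<delta>) * z\<^sup>2"
    using d by (simp add: field_simps)
  also have "\<dots> \<longleftrightarrow> sqrt a \<le> sqrt (\<delta> / (1 - \<delta>) * z\<^sup>2)" by simp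
  also have "sqrt (\<delta> / (1 - \<delta>) * z\<^sup>2) = sqrt (\<delta> / (1 - \<delta>)) * \<bar>z\<bar>"
    by (simp only: real_sqrt_mult real_sqrt_abs)
  finally have 1: "(1 - \<delta>) * (a + z\<^sup>2) \<le> z\<^sup>2 \<longleftrightarrow> sqrt a \<le> sqrt (\<delta> / (1 - \<delta>)) * \<bar>z\<bar>" .
  have 2: "a + z\<^sup>2 \<le> 1 \<longleftrightarrow> sqrt a \<le> sqrt (1 - z\<^sup>2)" by auto
  show ?thesis unfolding cap_radius_def 1 2 by auto
qed

text \<open>
  Slice perpendicular to the axis of the cone. For \<open>\<delta> = 0\<close> the sections are single points, which are
  null sets because \<open>J\<close> is nonempty.
\<close>

lemma ball_measure_cone_integral:
  fixes J :: "'i set"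
  assumes fin: "finite J" "J \<noteq> {}" and k: "k \<notin> J" and d: "0 \<le> \<delta>" "\<delta> < 1"
  defines "e \<equiv> (\<lambda>i. if i = k then 1 else 0 :: real)"
  shows "emeasure (ball_measure (insert k J)) {y \<in> space (ball_measure (insert k J)). in_cone (insert k J) (1 - \<delta>) e y} =
    ennreal (unit_ball_vol (real (card J))) *
      (\<integral>\<^sup>+ z. ennreal (cap_radius \<delta> z ^ card J) * indicator {-1..1} z \<partial>lborel)"
proof -
  interpret product_sigma_finite "\<lambda>_::'i. lborel :: real measure" by standard
  let ?I = "insert k J"
  let ?P = "PiM ?I (\<lambda>_. lborel) :: ('i \<Rightarrow> real) measure"
  let ?Q = "PiM J (\<lambda>_. lborel) :: ('i \<Rightarrow> real) measure"
  have [measurable_cong]: "sets ?P = sets (PiM ?I (\<lambda>_. borel))" by (rule sets_PiM_lborel)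
  have sp: "space (ball_measure ?I) = space ?P"
    using sets_eq_imp_space_eq[OF sets_ball_measure[of ?I]] by (simp add: space_PiM)
  have ee: "inner_on ?I e e = 1" "inner_on ?I e y = y k" for y
    using k fin by (simp_all add: inner_on_def e_def if_distrib[of "\<lambda>x. x * _"] sum.delta cong: if_cong)
  have meas: "{y \<in> space (PiM I (\<lambda>_. lborel)). (1 - \<delta>) * inner_on I y y \<le> (y k)\<^sup>2 \<and> inner_on I y y \<le> 1}
      \<in> sets (PiM I (\<lambda>_. lborel))"
    "{y \<in> space (PiM I (\<lambda>_. lborel)). in_cone I (1 - \<delta>) e y} \<in> sets (PiM I (\<lambda>_. lborel))"
    if kI: "k \<in> I" for I :: "'i set"
  proof -
    let ?B = "PiM I (\<lambda>_. borel :: real measure)"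
    have eq: "sets (PiM I (\<lambda>_. lborel :: real measure)) = sets ?B"
      "space (PiM I (\<lambda>_. lborel :: real measure)) = space ?B"
      by (rule sets_PiM_lborel) (simp add: space_PiM)
    have [measurable]: "(\<lambda>y. inner_on I y y) \<in> borel_measurable ?B" "(\<lambda>y. y k) \<in> borel_measurable ?B"
      using kI by measurable
    show "{y \<in> space (PiM I (\<lambda>_. lborel)). (1 - \<delta>) * inner_on I y y \<le> (y k)\<^sup>2 \<and> inner_on I y y \<le> 1}
        \<in> sets (PiM I (\<lambda>_. lborel))"
      unfolding eq by (rule sets.sets_Collect_conj; measurable)
    show "{y \<in> space (PiM I (\<lambda>_. lborel)). in_cone I (1 - \<delta>) e y} \<in> sets (PiM I (\<lambda>_. lborel))"
      unfolding eq in_cone_def by measurable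
  qed
  have ek: "e k = 1" by (simp add: e_def)
  let ?S = "{y \<in> space ?P. (1 - \<delta>) * inner_on ?I y y \<le> (y k)\<^sup>2 \<and> inner_on ?I y y \<le> 1}"
  have [measurable]: "?S \<in> sets ?P" by (rule meas(1)) simp
  have "emeasure (ball_measure ?I) {y \<in> space (ball_measure ?I). in_cone ?I (1 - \<delta>) e y} =
     emeasure ?P ({y \<in> space ?P. in_cone ?I (1 - \<delta>) e y} \<inter> unit_ball_on ?I)"
    unfolding sp
  proof (rule emeasure_ball_measure)
    have "{y \<in> space ?P. in_cone ?I (1 - \<delta>) e y} \<in> sets ?P"
      by (rule meas(2)) simp
    then show "{y \<in> space ?P. in_cone ?I (1 - \<delta>) e y} \<in> sets (PiM ?I (\<lambda>_. borel))"
      by (simp add: sets_PiM_lborel)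
  qed
  also have "{y \<in> space ?P. in_cone ?I (1 - \<delta>) e y} \<inter> unit_ball_on ?I = ?S"
    by (auto simp: in_cone_def unit_ball_on_def ee ek)
  also have "emeasure ?P ?S = (\<integral>\<^sup>+ y. indicator ?S y \<partial>?P)" by simp
  also have "\<dots> = (\<integral>\<^sup>+ z. (\<integral>\<^sup>+ x. indicator ?S (x(k := z)) \<partial>?Q) \<partial>lborel)"
    by (rule product_nn_integral_insert_rev[OF fin(1) k]) measurable
  also have "\<dots> = (\<integral>\<^sup>+ z. ennreal (unit_ball_vol (real (card J))) *
         (ennreal (cap_radius \<delta> z ^ card J) * indicator {-1..1} z) \<partial>lborel)"
  proof (rule nn_integral_cong_AE)
    have "AE z in lborel. z \<noteq> 0 \<and> z \<noteq> 1 \<and> z \<noteq> (-1::real)"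
      using AE_lborel_singleton[of "0::real"] AE_lborel_singleton[of "1::real"]
        AE_lborel_singleton[of "-1::real"] by eventually_elim simp
    then show "AE z in lborel. (\<integral>\<^sup>+ x. indicator ?S (x(k := z)) \<partial>?Q) =
       ennreal (unit_ball_vol (real (card J))) *
         (ennreal (cap_radius \<delta> z ^ card J) * indicator {-1..1} z)"
    proof eventually_elim
      case (elim z)
      have upd: "inner_on ?I (x(k := z)) (x(k := z)) = inner_on J x x + z\<^sup>2" for x
      proof -
        have "inner_on J (x(k := z)) (x(k := z)) = inner_on J x x"
          using k by (intro inner_on_cong) auto
        then show ?thesis using k fin by (simp add: inner_on_def power2_eq_square)
      qed
      have mem: "x(k := z) \<in> ?S \<longleftrightarrow>
          (1 - \<delta>) * (inner_on J x x + z\<^sup>2) \<le> z\<^sup>2 \<and> inner_on J x x + z\<^sup>2 \<le> 1"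
        if "x \<in> space ?Q" for x
        using that by (auto simp: upd space_PiM PiE_iff extensional_def)
      show ?case
      proof (cases "\<bar>z\<bar> \<le> 1")
        case False
        then have "z\<^sup>2 > 1" by (simp add: abs_square_less_1[symmetric] not_le abs_square_le_1[symmetric])
        then have "x(k := z) \<notin> ?S" if "x \<in> space ?Q" for x
          using mem[OF that] inner_on_self_nonneg[of J x] by linarith
        then have "(\<integral>\<^sup>+ x. indicator ?S (x(k := z)) \<partial>?Q) = (\<integral>\<^sup>+ x. 0 \<partial>?Q)"
          by (intro nn_integral_cong) (simp add: indicator_def)
        then show ?thesis using False by (auto simp: indicator_def)
      next
        case True
        let ?r = "cap_radius \<delta> z"
        have "\<bar>z\<bar> \<noteq> 1" using elim abs_eq_iff[of z 1] by simp
        then have z1: "z\<^sup>2 < 1" using True by (simp add: abs_square_less_1)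
        let ?B = "{f. sqrt (\<Sum>i\<in>J. (f i)\<^sup>2) \<le> ?r} \<inter> space ?Q"
        have "x(k := z) \<in> ?S \<longleftrightarrow> x \<in> ?B" if "x \<in> space ?Q" for x
          unfolding mem[OF that] cap_section[OF d True inner_on_self_nonneg]
          using that by (simp add: inner_on_def power2_eq_square)
        then have "(\<integral>\<^sup>+ x. indicator ?S (x(k := z)) \<partial>?Q) = (\<integral>\<^sup>+ x. indicator ?B x \<partial>?Q)"
          by (intro nn_integral_cong) (simp add: indicator_def)
        also have "\<dots> = emeasure ?Q ?B"
        proof (rule nn_integral_indicator)
          have [measurable_cong]: "sets ?Q = sets (PiM J (\<lambda>_. borel))" by (rule sets_PiM_lborel)
          have "?B = {x \<in> space ?Q. sqrt (\<Sum>i\<in>J. (x i)\<^sup>2) \<le> ?r}" by auto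
          also have "\<dots> \<in> sets ?Q" by measurable
          finally show "?B \<in> sets ?Q" .
        qed
        also have "\<dots> = ennreal (unit_ball_vol (real (card J)) * ?r ^ card J)"
        \<comment> \<open>The volume formula for balls is stated for positive radius; radius 0 is needed for \<open>\<delta> = 0\<close>.\<close>
        proof (cases "\<delta> = 0")
          case False
          then have "?r > 0" using d z1 elim by (simp add: cap_radius_def)
          then show ?thesis by (rule emeasure_cball_aux[OF fin(1)])
        next
          case True
          then have r: "?r = 0" using z1 by (simp add: cap_radius_def)
          obtain j where j: "j \<in> J" using fin by auto
          have "?B = (\<Pi>\<^sub>E i\<in>J. {0})"
          proof -
            have "sqrt (\<Sum>i\<in>J. (f i)\<^sup>2) \<le> 0 \<longleftrightarrow> (\<forall>i\<in>J. f i = 0)" for f :: "'i \<Rightarrow> real"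
            proof -
              have "(\<Sum>i\<in>J. (f i)\<^sup>2) \<ge> 0" by (rule sum_nonneg) simp
              then have "sqrt (\<Sum>i\<in>J. (f i)\<^sup>2) \<le> 0 \<longleftrightarrow> (\<Sum>i\<in>J. (f i)\<^sup>2) = 0"
                unfolding real_sqrt_le_0_iff by linarith
              also have "\<dots> \<longleftrightarrow> (\<forall>i\<in>J. (f i)\<^sup>2 = 0)" by (rule sum_nonneg_eq_0_iff[OF fin(1)]) simp
              finally show ?thesis by simp
            qed
            then show ?thesis unfolding r by (auto simp: space_PiM PiE_iff extensional_def fun_eq_iff)
          qed
          also have "emeasure ?Q \<dots> = (\<Prod>i\<in>J. emeasure lborel {0::real})"
            by (rule emeasure_PiM[OF fin(1)]) simp
          also have "\<dots> = 0" using j fin by (auto intro: prod_zero)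
          finally show ?thesis using r fin by (simp add: card_gt_0_iff)
        qed
        finally show ?thesis using True
          by (simp add: indicator_def ennreal_mult' abs_le_iff)
      qed
    qed
  qed
  also have "\<dots> = ennreal (unit_ball_vol (real (card J))) *
      (\<integral>\<^sup>+ z. ennreal (cap_radius \<delta> z ^ card J) * indicator {-1..1} z \<partial>lborel)"
    by (rule nn_integral_cmult) (unfold cap_radius_def, measurable)
  finally show ?thesis .
qed

lemma cancel_quotient:
  "b \<noteq> 0 \<Longrightarrow> k \<noteq> 0 \<Longrightarrow> - (- (k * z * t) / (b * k)) = z / b * (t :: real)" by simp

lemma half_quotient: "2 * x / y / 2 = x / (y :: real)" by simp

text \<open>
  Up to \<open>z = sqrt (1 - \<delta>)\<close> the radius is linear in \<open>z\<close>, and that part of the integral is exactly the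
  lower bound. Beyond it, the factor \<open>z / sqrt (1 - \<delta>) \<ge> 1\<close> makes \<open>sqrt (1 - z\<^sup>2) ^ m\<close> explicitly
  integrable. The remaining term \<open>\<delta> / sqrt (1 - \<delta>)\<close> has no factor \<open>m\<close>; this matters, because \<open>n * \<delta>\<close>
  does not tend to 0 in general.
\<close>

lemma cap_integral_bounds:
  fixes \<delta> :: real and m :: nat
  assumes d: "0 \<le> \<delta>" "\<delta> < 1" and m: "m \<ge> 1"
  defines "A \<equiv> (\<integral>\<^sup>+ z. ennreal (cap_radius \<delta> z ^ m) * indicator {-1..1} z \<partial>lborel)"
  defines "c \<equiv> 2 * sqrt \<delta> ^ m / real (m + 1)"
  shows "A \<ge> ennreal (c * sqrt (1 - \<delta>))"
    and "A \<le> ennreal (c * (sqrt (1 - \<delta>) + \<delta> / sqrt (1 - \<delta>)))"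
proof -
  define b where "b = sqrt (1 - \<delta>)"
  have b: "0 < b" "b \<le> 1" "b\<^sup>2 = 1 - \<delta>" using d by (auto simp: b_def)
  define k where "k = sqrt (\<delta> / (1 - \<delta>))"
  have k: "k \<ge> 0" using d by (simp add: k_def)
  have kb: "k = sqrt \<delta> / b" by (simp add: k_def b_def real_sqrt_divide)
  let ?f = "\<lambda>z. ennreal (cap_radius \<delta> z ^ m) * indicator {-1..1} z"
  have [measurable]: "cap_radius \<delta> \<in> borel_measurable borel" unfolding cap_radius_def by measurable
  have "A = 2 * (\<integral>\<^sup>+ z. ?f z * indicator {0..} z \<partial>lborel)"
    unfolding A_def by (rule nn_integral_even) (measurable, auto simp: cap_radius_def indicator_def)
  also have "(\<integral>\<^sup>+ z. ?f z * indicator {0..} z \<partial>lborel) =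
     (\<integral>\<^sup>+ z. ennreal (cap_radius \<delta> z ^ m) * indicator {0..1} z \<partial>lborel)"
    by (intro nn_integral_cong) (auto simp: indicator_def)
  finally have A: "A = 2 * (\<integral>\<^sup>+ z. ennreal (cap_radius \<delta> z ^ m) * indicator {0..1} z \<partial>lborel)" .
  have r1: "cap_radius \<delta> z = k * z" if "0 \<le> z" "z \<le> b" for z
  proof -
    have "z\<^sup>2 \<le> 1 - \<delta>" using power_mono[OF that(2,1), of 2] b by simp
    then have "\<delta> / (1 - \<delta>) * z\<^sup>2 \<le> 1 - z\<^sup>2" using d by (simp add: field_simps)
    then have "sqrt (\<delta> / (1 - \<delta>) * z\<^sup>2) \<le> sqrt (1 - z\<^sup>2)" by simp
    then have "k * \<bar>z\<bar> \<le> sqrt (1 - z\<^sup>2)" by (simp only: real_sqrt_mult real_sqrt_abs k_def)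
    then show ?thesis using that by (simp add: cap_radius_def k_def)
  qed
  have I1: "(\<integral>\<^sup>+ z. ennreal ((k * z) ^ m) * indicator {0..b} z \<partial>lborel) = ennreal (c / 2 * b)"
  proof -
    have "(\<integral>\<^sup>+ z. ennreal ((k * z) ^ m) * indicator {0..b} z \<partial>lborel) =
      ennreal (k ^ m / real (m + 1) * b ^ (m + 1) - k ^ m / real (m + 1) * 0 ^ (m + 1))"
    proof (rule nn_integral_FTC_Icc)
      show "((\<lambda>z. k ^ m / real (m + 1) * z ^ (m + 1)) has_real_derivative (k * x) ^ m) (at x)" for x
        using DERIV_cmult[OF DERIV_pow[of "m + 1"], of "k ^ m / real (m + 1)" x UNIV]
        by (simp add: power_mult_distrib)
    qed (use k b in auto)
    also have "k ^ m / real (m + 1) * b ^ (m + 1) - k ^ m / real (m + 1) * 0 ^ (m + 1) = c / 2 * b"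
    proof -
      have "k ^ m * b ^ (m + 1) = sqrt \<delta> ^ m * b"
        using b by (simp add: kb power_divide)
      then have "k ^ m / real (m + 1) * b ^ (m + 1) = sqrt \<delta> ^ m * b / real (m + 1)" by simp
      then have "k ^ m / real (m + 1) * b ^ (m + 1) = c / 2 * b"
        by (simp only: c_def half_quotient times_divide_eq_left)
      then show ?thesis by simp
    qed
    finally show ?thesis .
  qed
  have I2: "(\<integral>\<^sup>+ z. ennreal (z / b * sqrt (1 - z\<^sup>2) ^ m) * indicator {b..1} z \<partial>lborel) \<le> ennreal (c / 2 * (\<delta> / b))"
  proof -
    define F where "F = (\<lambda>z. - (sqrt (1 - z\<^sup>2) ^ (m + 2) / (b * real (m + 2))))"
    have der: "(F has_real_derivative z / b * sqrt (1 - z\<^sup>2) ^ m) (at z)" if z: "z \<in> {b<..<1}" for z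
    proof -
      have z2: "0 < 1 - z\<^sup>2" using z b by (simp add: abs_square_less_1)
      have "((\<lambda>z. sqrt (1 - z\<^sup>2)) has_real_derivative (inverse (sqrt (1 - z\<^sup>2)) / 2 * (0 - 2 * z))) (at z)"
        using z2 by (auto intro!: derivative_eq_intros)
      from DERIV_power[OF this, of "m + 2"]
      have "((\<lambda>z. sqrt (1 - z\<^sup>2) ^ (m + 2)) has_real_derivative
          - (real (m + 2) * z * sqrt (1 - z\<^sup>2) ^ m)) (at z)"
        using z2 by (simp add: field_simps)
      from DERIV_minus[OF DERIV_cdivide[OF this, of "b * real (m + 2)"]]
      have "(F has_real_derivative - (- (real (m + 2) * z * sqrt (1 - z\<^sup>2) ^ m) / (b * real (m + 2)))) (at z)"
        unfolding F_def .
      also have "- (- (real (m + 2) * z * sqrt (1 - z\<^sup>2) ^ m) / (b * real (m + 2))) = z / b * sqrt (1 - z\<^sup>2) ^ m"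
        using b(1) by (intro cancel_quotient) auto
      finally show ?thesis .
    qed
    have "((\<lambda>z. z / b * sqrt (1 - z\<^sup>2) ^ m) has_integral (F 1 - F b)) {b..1}"
    proof (rule fundamental_theorem_of_calculus_interior)
      show "continuous_on {b..1} F" unfolding F_def using b by (intro continuous_intros) auto
    qed (use b der in \<open>auto simp: has_real_derivative_iff_has_vector_derivative[symmetric]\<close>)
    then have "((\<lambda>z. if z \<in> {b..1} then z / b * sqrt (1 - z\<^sup>2) ^ m else 0) has_integral (F 1 - F b)) UNIV"
      by (simp only: has_integral_restrict_UNIV)
    also have "(\<lambda>z. if z \<in> {b..1} then z / b * sqrt (1 - z\<^sup>2) ^ m else 0) =
        (\<lambda>z. indicator {b..1} z * (z / b * sqrt (1 - z\<^sup>2) ^ m))"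
      by (auto simp: fun_eq_iff)
    finally have int: "((\<lambda>z. indicator {b..1} z * (z / b * sqrt (1 - z\<^sup>2) ^ m)) has_integral (F 1 - F b)) UNIV" .
    have "(\<integral>\<^sup>+ z. ennreal (z / b * sqrt (1 - z\<^sup>2) ^ m) * indicator {b..1} z \<partial>lborel) =
      (\<integral>\<^sup>+ z. ennreal (indicator {b..1} z * (z / b * sqrt (1 - z\<^sup>2) ^ m)) \<partial>lborel)"
      by (rule nn_integral_cong) (auto simp: indicator_def)
    also have "\<dots> = ennreal (F 1 - F b)"
    proof (rule nn_integral_has_integral_lborel[OF _ _ int])
      show "0 \<le> indicator {b..1} z * (z / b * sqrt (1 - z\<^sup>2) ^ m)" for z
        using b by (auto simp: indicator_def power_le_one)
    qed measurable
    also have "\<dots> = ennreal (sqrt \<delta> ^ (m + 2) / (b * real (m + 2)))"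
      using b by (simp add: F_def)
    also have "\<dots> \<le> ennreal (c / 2 * (\<delta> / b))"
    proof (rule ennreal_leI)
      have "sqrt \<delta> ^ (m + 2) / (b * real (m + 2)) \<le> sqrt \<delta> ^ (m + 2) / (b * real (m + 1))"
        using b d by (intro divide_left_mono mult_left_mono mult_pos_pos) auto
      also have "\<dots> = sqrt \<delta> ^ m / real (m + 1) * (\<delta> / b)"
        using d by (simp add: power_add mult_ac)
      also have "\<dots> = c / 2 * (\<delta> / b)"
        by (simp only: c_def half_quotient)
      finally show "sqrt \<delta> ^ (m + 2) / (b * real (m + 2)) \<le> c / 2 * (\<delta> / b)" .
    qed
    finally show ?thesis .
  qed
  have c0: "c \<ge> 0" using d by (simp add: c_def)
  have two: "2 * ennreal (c / 2 * x) = ennreal (c * x)" for x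
  proof -
    have "ennreal (c * x) = ennreal (2 * (c / 2 * x))" by simp
    also have "\<dots> = ennreal 2 * ennreal (c / 2 * x)" by (rule ennreal_mult') simp
    finally show ?thesis by simp
  qed
  have "ennreal (c / 2 * b) \<le> (\<integral>\<^sup>+ z. ennreal (cap_radius \<delta> z ^ m) * indicator {0..1} z \<partial>lborel)"
    unfolding I1[symmetric] by (rule nn_integral_mono) (use b r1 in \<open>auto simp: indicator_def\<close>)
  then have "2 * ennreal (c / 2 * b) \<le> A" unfolding A by (rule mult_left_mono) simp
  then show "A \<ge> ennreal (c * sqrt (1 - \<delta>))"
    using b unfolding b_def[symmetric] by (simp only: two)
  have "(\<integral>\<^sup>+ z. ennreal (cap_radius \<delta> z ^ m) * indicator {0..1} z \<partial>lborel) \<le>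
     (\<integral>\<^sup>+ z. ennreal ((k * z) ^ m) * indicator {0..b} z +
       ennreal (z / b * sqrt (1 - z\<^sup>2) ^ m) * indicator {b..1} z \<partial>lborel)"
  proof (rule nn_integral_mono)
    fix z :: real
    consider "z < 0 \<or> z > 1" | "0 \<le> z" "z \<le> b" | "b < z" "z \<le> 1" by linarith
    then show "ennreal (cap_radius \<delta> z ^ m) * indicator {0..1} z \<le>
       ennreal ((k * z) ^ m) * indicator {0..b} z + ennreal (z / b * sqrt (1 - z\<^sup>2) ^ m) * indicator {b..1} z"
    proof cases
      case 2
      then show ?thesis using r1[of z] b by (auto simp: indicator_def)
    next
      case 3
      have z2: "z\<^sup>2 \<le> 1" using 3 b by (simp add: power_le_one)
      have "cap_radius \<delta> z ^ m \<le> sqrt (1 - z\<^sup>2) ^ m"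
        using k 3 b z2 by (intro power_mono) (auto simp: cap_radius_def k_def)
      also have "\<dots> \<le> z / b * sqrt (1 - z\<^sup>2) ^ m"
        using 3 b z2 mult_right_mono[of 1 "z / b" "sqrt (1 - z\<^sup>2) ^ m"] by (simp add: field_simps)
      finally have "cap_radius \<delta> z ^ m \<le> z / b * sqrt (1 - z\<^sup>2) ^ m" .
      then show ?thesis using 3 b by (simp add: indicator_def ennreal_leI)
    qed (auto simp: indicator_def)
  qed
  also have "\<dots> = (\<integral>\<^sup>+ z. ennreal ((k * z) ^ m) * indicator {0..b} z \<partial>lborel) +
     (\<integral>\<^sup>+ z. ennreal (z / b * sqrt (1 - z\<^sup>2) ^ m) * indicator {b..1} z \<partial>lborel)"
    by (rule nn_integral_add) measurable
  also have "\<dots> \<le> ennreal (c / 2 * b) + ennreal (c / 2 * (\<delta> / b))"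
    unfolding I1 by (intro add_mono I2 order_refl)
  finally have "A \<le> 2 * (ennreal (c / 2 * b) + ennreal (c / 2 * (\<delta> / b)))"
    unfolding A by (rule mult_left_mono) simp
  also have "\<dots> = ennreal (c * (sqrt (1 - \<delta>) + \<delta> / sqrt (1 - \<delta>)))"
  proof -
    have "2 * (ennreal (c / 2 * b) + ennreal (c / 2 * (\<delta> / b))) = ennreal (c * b) + ennreal (c * (\<delta> / b))"
      by (simp only: distrib_left two)
    also have "\<dots> = ennreal (c * b + c * (\<delta> / b))"
      using c0 b d by (intro ennreal_plus[symmetric]) auto
    finally show ?thesis unfolding b_def[symmetric] by (simp only: distrib_left)
  qed
  finally show "A \<le> ennreal (c * (sqrt (1 - \<delta>) + \<delta> / sqrt (1 - \<delta>)))" .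
qed

text \<open>
  The probability, under any spherical law on \<open>R\<^sup>d\<close> without an atom at 0, that the squared cosine with
  a given direction is at least \<open>1 - \<delta>\<close>; see \<open>cone_measure_eq_cap_fraction\<close>.
\<close>

definition cap_fraction :: "nat \<Rightarrow> real \<Rightarrow> real" where
  "cap_fraction d \<delta> = measure (ball_measure {1..d})
     {y \<in> space (ball_measure {1..d}). in_cone {1..d} (1 - \<delta>) (\<lambda>i. if i = d then 1 else 0) y}
     / unit_ball_vol (real d)"

lemma finite_measure_ball_measure: "finite I \<Longrightarrow> finite_measure (ball_measure I)"
  by (rule finite_measureI) (simp add: ball_measure_space)

lemma cap_fraction_bounds:
  assumes d: "d \<ge> 2" and \<delta>: "0 \<le> \<delta>" "\<delta> < 1"
  defines "c \<equiv> unit_ball_vol (real (d - 1)) / unit_ball_vol (real d) * (2 * sqrt \<delta> ^ (d - 1) / real d)"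
  shows "c * sqrt (1 - \<delta>) \<le> cap_fraction d \<delta>"
    and "cap_fraction d \<delta> \<le> c * (sqrt (1 - \<delta>) + \<delta> / sqrt (1 - \<delta>))"
proof -
  let ?e = "\<lambda>i. if i = d then 1 else 0 :: real"
  let ?C = "{y \<in> space (ball_measure {1..d}). in_cone {1..d} (1 - \<delta>) ?e y}"
  define A where "A = (\<integral>\<^sup>+ z. ennreal (cap_radius \<delta> z ^ (d - 1)) * indicator {-1..1} z \<partial>lborel)"
  define k where "k = 2 * sqrt \<delta> ^ (d - 1) / real d"
  define V where "V = unit_ball_vol (real (d - 1))"
  define W where "W = unit_ball_vol (real d)"
  have pos: "V > 0" "W > 0" by (simp_all add: V_def W_def)
  have I: "{1..d} = insert d {1..d - 1}" using d by auto
  have E: "emeasure (ball_measure {1..d}) ?C = ennreal V * A"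
  proof -
    let ?I = "insert d {1..d - 1}"
    have card: "card {1..d - 1} = d - 1" by simp
    have "emeasure (ball_measure ?I) {y \<in> space (ball_measure ?I). in_cone ?I (1 - \<delta>) ?e y} =
        ennreal (unit_ball_vol (real (card {1..d - 1}))) *
        (\<integral>\<^sup>+ z. ennreal (cap_radius \<delta> z ^ card {1..d - 1}) * indicator {-1..1} z \<partial>lborel)"
      by (rule ball_measure_cone_integral) (use d \<delta> in auto)
    then show ?thesis unfolding card I[symmetric] V_def A_def .
  qed
  have lo: "ennreal (k * sqrt (1 - \<delta>)) \<le> A" and hi: "A \<le> ennreal (k * (sqrt (1 - \<delta>) + \<delta> / sqrt (1 - \<delta>)))"
    using cap_integral_bounds[OF \<delta>, of "d - 1"] d by (simp_all add: A_def k_def)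
  interpret finite_measure "ball_measure {1..d}" by (rule finite_measure_ball_measure) simp
  have k0: "k \<ge> 0" using \<delta> by (simp add: k_def)
  have "ennreal (V * (k * sqrt (1 - \<delta>))) \<le> ennreal V * A"
    using lo pos by (subst ennreal_mult') (auto intro: mult_left_mono)
  then have "ennreal (V * (k * sqrt (1 - \<delta>))) \<le> ennreal (measure (ball_measure {1..d}) ?C)"
    by (simp only: E emeasure_eq_measure[symmetric])
  then have 1: "V * (k * sqrt (1 - \<delta>)) \<le> measure (ball_measure {1..d}) ?C" by simp
  have "ennreal V * A \<le> ennreal (V * (k * (sqrt (1 - \<delta>) + \<delta> / sqrt (1 - \<delta>))))"
    using hi pos by (subst ennreal_mult') (auto intro: mult_left_mono)
  then have "ennreal (measure (ball_measure {1..d}) ?C) \<le> ennreal (V * (k * (sqrt (1 - \<delta>) + \<delta> / sqrt (1 - \<delta>))))"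
    by (simp only: E emeasure_eq_measure[symmetric])
  then have 2: "measure (ball_measure {1..d}) ?C \<le> V * (k * (sqrt (1 - \<delta>) + \<delta> / sqrt (1 - \<delta>)))"
    using pos k0 \<delta> by (subst (asm) ennreal_le_iff) auto
  have c: "c = V / W * k" by (simp add: c_def V_def W_def k_def)
  have q: "cap_fraction d \<delta> = measure (ball_measure {1..d}) ?C / W" by (simp add: cap_fraction_def W_def)
  show "c * sqrt (1 - \<delta>) \<le> cap_fraction d \<delta>"
    using divide_right_mono[OF 1, of W] pos by (simp add: c q)
  show "cap_fraction d \<delta> \<le> c * (sqrt (1 - \<delta>) + \<delta> / sqrt (1 - \<delta>))"
    using divide_right_mono[OF 2, of W] pos by (simp add: c q)
qed

lemma cap_fraction_0: "d \<ge> 2 \<Longrightarrow> cap_fraction d 0 = 0"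
  using cap_fraction_bounds[of d 0] by simp

lemma cone_measure_eq_cap_fraction:
  assumes d: "d \<ge> 2" and inv: "reflection_invariant {1..d} \<mu>" and "prob_space \<mu>"
    and null: "emeasure \<mu> {y \<in> space \<mu>. inner_on {1..d} y y = 0} = 0"
    and x: "inner_on {1..d} x x > 0"
  shows "measure \<mu> {y \<in> space \<mu>. in_cone {1..d} (1 - \<delta>) x y} = cap_fraction d \<delta>"
proof -
  interpret m: prob_space \<mu> by fact
  let ?I = "{1..d}"
  let ?b = "ball_measure ?I"
  let ?e = "\<lambda>i. if i = d then 1 else 0 :: real"
  interpret b: finite_measure ?b by (rule finite_measure_ball_measure) simp
  have e: "inner_on ?I ?e ?e > 0" by (subst inner_on_self_pos_iff) (use d in auto)
  have V: "unit_ball_vol (real d) > 0" by simp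
  have b0: "emeasure ?b {y \<in> space ?b. inner_on ?I y y = 0} = 0"
  proof -
    have "measure ?b {y \<in> space ?b. in_cone ?I 1 ?e y} = 0"
      using cap_fraction_0[OF d] V by (simp add: cap_fraction_def)
    then have "emeasure ?b {y \<in> space ?b. in_cone ?I 1 ?e y} = 0"
      by (simp only: b.emeasure_eq_measure ennreal_0)
    moreover have "emeasure ?b {y \<in> space ?b. inner_on ?I y y = 0} \<le> emeasure ?b {y \<in> space ?b. in_cone ?I 1 ?e y}"
    proof (rule emeasure_mono)
      show "{y \<in> space ?b. in_cone ?I 1 ?e y} \<in> sets ?b"
        unfolding in_cone_def by measurable
    qed (auto simp: in_cone_def)
    ultimately show ?thesis by simp
  qed
  have "emeasure \<mu> {y \<in> space \<mu>. in_cone ?I (1 - \<delta>) ?e y} * emeasure ?b (space ?b) =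
        emeasure ?b {y \<in> space ?b. in_cone ?I (1 - \<delta>) ?e y} * emeasure \<mu> (space \<mu>)"
    by (rule cone_measure_ratio[OF _ inv ball_measure_reflection_invariant])
      (use null b0 e m.finite_measure_axioms b.finite_measure_axioms in auto)
  moreover have "emeasure \<mu> {y \<in> space \<mu>. in_cone ?I (1 - \<delta>) ?e y} = emeasure \<mu> {y \<in> space \<mu>. in_cone ?I (1 - \<delta>) x y}"
    by (rule cone_measure_const[OF _ inv e x]) simp
  ultimately have "emeasure \<mu> {y \<in> space \<mu>. in_cone ?I (1 - \<delta>) x y} * ennreal (unit_ball_vol (real d)) =
        emeasure ?b {y \<in> space ?b. in_cone ?I (1 - \<delta>) ?e y}"
    by (simp add: ball_measure_space m.emeasure_space_1)
  then have "ennreal (measure \<mu> {y \<in> space \<mu>. in_cone ?I (1 - \<delta>) x y} * unit_ball_vol (real d)) =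
        ennreal (measure ?b {y \<in> space ?b. in_cone ?I (1 - \<delta>) ?e y})"
    unfolding m.emeasure_eq_measure b.emeasure_eq_measure by (simp add: ennreal_mult)
  then have "measure \<mu> {y \<in> space \<mu>. in_cone ?I (1 - \<delta>) x y} * unit_ball_vol (real d) =
        measure ?b {y \<in> space ?b. in_cone ?I (1 - \<delta>) ?e y}"
    by (subst (asm) ennreal_inj) auto
  moreover have "unit_ball_vol (real d) \<noteq> 0" using V by (rule less_imp_neq[THEN not_sym])
  ultimately show ?thesis unfolding cap_fraction_def by (intro eq_divide_imp)
qed

section \<open>Spherical laws and the Pearson correlation\<close>

text \<open>
  A reflection of the smaller space is the restriction of the reflection of the larger space along
  the same vector, extended by zeros.
\<close>

lemma reflection_invariant_restrict:
  assumes fin: "finite I" and JI: "J \<subseteq> I" and inv: "reflection_invariant I \<mu>"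
  shows "reflection_invariant J (distr \<mu> (PiM J (\<lambda>_. borel)) (\<lambda>y. restrict y J))"
  unfolding reflection_invariant_def
proof (intro conjI allI)
  fix w :: "'a \<Rightarrow> real"
  let ?PI = "PiM I (\<lambda>_. borel) :: ('a \<Rightarrow> real) measure"
  let ?PJ = "PiM J (\<lambda>_. borel) :: ('a \<Rightarrow> real) measure"
  let ?r = "\<lambda>y. restrict y J"
  let ?w = "\<lambda>i. if i \<in> J then w i else 0"
  have r: "?r \<in> measurable ?PI ?PJ"
    using JI by (intro measurable_restrict) auto
  have sets: "sets \<mu> = sets ?PI" using inv by (simp add: reflection_invariant_def)
  have r': "?r \<in> measurable \<mu> ?PJ" using r by (simp add: measurable_cong_sets[OF sets refl])
  have m: "reflect I v \<in> measurable \<mu> ?PI" for v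
    using measurable_reflect[of I v] by (simp add: measurable_cong_sets[OF sets refl])
  have in_w: "inner_on I ?w y = inner_on J w y" for y
  proof -
    have "(\<Sum>i\<in>I. ?w i * y i) = (\<Sum>i\<in>J. ?w i * y i)"
      using fin JI by (intro sum.mono_neutral_right) auto
    then show ?thesis by (simp add: inner_on_def)
  qed
  have "inner_on I ?w ?w = inner_on J w w"
    unfolding in_w by (intro inner_on_cong) auto
  then have comm: "reflect J w (?r y) = ?r (reflect I ?w y)" for y
    using JI by (auto simp: reflect_def in_w fun_eq_iff)
  have "distr (distr \<mu> ?PJ ?r) ?PJ (reflect J w) = distr \<mu> ?PJ (reflect J w \<circ> ?r)"
    by (rule distr_distr[OF measurable_reflect r'])
  also have "reflect J w \<circ> ?r = ?r \<circ> reflect I ?w"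
    using comm by (auto simp: fun_eq_iff)
  also have "distr \<mu> ?PJ (?r \<circ> reflect I ?w) = distr (distr \<mu> ?PI (reflect I ?w)) ?PJ ?r"
    by (rule distr_distr[OF r m, symmetric])
  also have "distr \<mu> ?PI (reflect I ?w) = \<mu>"
    using inv by (simp add: reflection_invariant_def)
  finally show "distr (distr \<mu> ?PJ ?r) ?PJ (reflect J w) = distr \<mu> ?PJ ?r" .
qed simp

text \<open>
  The matrix of \<^const>\<open>reflect\<close>, used to read off reflection-invariance from sphericity.
\<close>

definition householder :: "nat \<Rightarrow> (nat \<Rightarrow> real) \<Rightarrow> nat \<Rightarrow> nat \<Rightarrow> real" where
  "householder n w i k = (if i = k then 1 else 0) - 2 * w i * w k / inner_on {1..n} w w"

lemma inner_on_unit: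
  assumes "finite I" "i \<in> I"
  shows "inner_on I y (\<lambda>k. if k = i then 1 else 0) = y i"
  using assms by (simp add: inner_on_def if_distrib[of "\<lambda>x. _ * x"] sum.delta cong: if_cong)

lemma orthogonal_householder: "orthogonal_mat n (householder n w)"
  unfolding orthogonal_mat_def
proof (intro ballI conjI)
  fix i j assume ij: "i \<in> {1..n}" "j \<in> {1..n}"
  let ?I = "{1..n}"
  let ?e = "\<lambda>i k. if k = i then 1 else 0 :: real"
  have col: "householder n w k l = reflect ?I w (?e l) k" if "k \<in> ?I" "l \<in> ?I" for k l
    using that by (simp add: householder_def reflect_def inner_on_unit)
  have "(\<Sum>k=1..n. householder n w k i * householder n w k j) =
        inner_on ?I (reflect ?I w (?e i)) (reflect ?I w (?e j))"
    unfolding inner_on_def using col ij by (intro sum.cong) auto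
  also have "\<dots> = (if i = j then 1 else 0)"
    using ij by (simp add: inner_on_unit)
  finally show *: "(\<Sum>k=1..n. householder n w k i * householder n w k j) = (if i = j then 1 else 0)" .
  have sym: "householder n w k l = householder n w l k" for k l
    by (simp add: householder_def mult_ac)
  show "(\<Sum>k=1..n. householder n w i k * householder n w j k) = (if i = j then 1 else 0)"
    using * by (simp add: sym[of i] sym[of j])
qed

lemma mat_vec_householder: "mat_vec n (householder n w) x = reflect {1..n} w x"
proof (rule ext)
  fix i
  show "mat_vec n (householder n w) x i = reflect {1..n} w x i"
  proof (cases "i \<in> {1..n}")
    case True
    have lin: "(\<Sum>k=1..n. c * (w k * x k)) = c * inner_on {1..n} w x" for c
      by (simp add: inner_on_def sum_distrib_left)
    have "(\<Sum>k=1..n. householder n w i k * x k) =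
        (\<Sum>k=1..n. (if k = i then x k else 0)) - (\<Sum>k=1..n. 2 * w i / inner_on {1..n} w w * (w k * x k))"
      unfolding sum_subtractf[symmetric]
      by (intro sum.cong) (auto simp: householder_def algebra_simps)
    also have "\<dots> = x i - 2 * inner_on {1..n} w x / inner_on {1..n} w w * w i"
      unfolding lin using True by (simp add: sum.delta)
    finally show ?thesis using True by (simp add: mat_vec_def reflect_def)
  qed (auto simp: mat_vec_def reflect_def)
qed

lemma spherical_reflection_invariant:
  assumes "spherical M n Y"
  shows "reflection_invariant {1..n} (distr M (Rn n) Y)"
  unfolding reflection_invariant_def
proof (intro conjI allI)
  fix w
  have Y: "Y \<in> measurable M (Rn n)" using assms by (simp add: spherical_def)
  have Rn: "PiM {1..n} (\<lambda>_. borel) = Rn n" by (simp add: Rn_def)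
  have "distr (distr M (Rn n) Y) (Rn n) (reflect {1..n} w) = distr M (Rn n) (reflect {1..n} w \<circ> Y)"
    by (rule distr_distr[OF _ Y]) (unfold Rn_def, rule measurable_reflect)
  also have "reflect {1..n} w \<circ> Y = (\<lambda>\<omega>. mat_vec n (householder n w) (Y \<omega>))"
    by (simp add: mat_vec_householder fun_eq_iff)
  also have "distr M (Rn n) \<dots> = distr M (Rn n) Y"
    using assms orthogonal_householder by (simp add: spherical_def)
  finally show "distr (distr M (Rn n) Y) (PiM {1..n} (\<lambda>_. borel)) (reflect {1..n} w) = distr M (Rn n) Y"
    by (simp only: Rn)
qed (simp add: Rn_def)

text \<open>
  The reflection that takes \<open>(1,...,1)\<close> to \<open>sqrt n\<close> times the last unit vector. Subtracting the mean
  is the projection along \<open>(1,...,1)\<close>; in the reflected coordinates it just drops the last one.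
\<close>

definition centering :: "nat \<Rightarrow> (nat \<Rightarrow> real) \<Rightarrow> nat \<Rightarrow> real" where
  "centering n = reflect {1..n} (\<lambda>i. 1 - (if i = n then sqrt (real n) else 0))"

lemma inner_on_centering:
  assumes n: "n \<ge> 1"
  shows "inner_on {1..n - 1} (centering n x) (centering n y) =
         (\<Sum>i=1..n. (x i - mean n x) * (y i - mean n y))"
proof -
  let ?I = "{1..n}"
  let ?s = "\<lambda>i. if i = n then sqrt (real n) else 0 :: real"
  let ?H = "centering n"
  have "inner_on ?I ?s ?s = sqrt (real n) * sqrt (real n)"
  proof -
    have "?s = (\<lambda>i. sqrt (real n) * (if i = n then 1 else 0))" by auto
    then have "inner_on ?I ?s ?s = sqrt (real n) * (sqrt (real n) * inner_on ?I (\<lambda>i. if i = n then 1 else 0) (\<lambda>i. if i = n then 1 else 0))"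
      by (simp only: inner_on_scale_left inner_on_scale_right)
    then show ?thesis using n by (simp add: inner_on_unit)
  qed
  also have "\<dots> = inner_on ?I (\<lambda>_. 1) (\<lambda>_. 1)" by (simp add: inner_on_def)
  finally have "inner_on ?I (\<lambda>_. 1) (\<lambda>_. 1) = inner_on ?I ?s ?s" ..
  from reflect_exchange[OF _ this]
  have H1: "?H (\<lambda>_. 1) = restrict ?s ?I" by (simp add: centering_def)
  have last: "sqrt (real n) * ?H z n = (\<Sum>i=1..n. z i)" for z
  proof -
    have "(\<Sum>i=1..n. z i) = inner_on ?I z (\<lambda>_. 1)" by (simp add: inner_on_def)
    also have "\<dots> = inner_on ?I (?H z) (?H (\<lambda>_. 1))" by (simp add: centering_def)
    also have "\<dots> = inner_on ?I (?H z) (\<lambda>i. sqrt (real n) * (if i = n then 1 else 0))"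
      unfolding H1 by (intro inner_on_cong) auto
    also have "\<dots> = sqrt (real n) * ?H z n"
      unfolding inner_on_scale_right using n by (subst inner_on_unit) auto
    finally show ?thesis by simp
  qed
  have I: "?I = insert n {1..n - 1}" using n by auto
  have "inner_on ?I x y = inner_on ?I (?H x) (?H y)" by (simp add: centering_def)
  also have "\<dots> = ?H x n * ?H y n + inner_on {1..n - 1} (?H x) (?H y)"
    unfolding inner_on_def I using n by (subst sum.insert) auto
  also have "?H x n * ?H y n = (\<Sum>i=1..n. x i) * (\<Sum>i=1..n. y i) / real n"
    unfolding last[symmetric] using n by (simp add: field_simps)
  finally have 1: "inner_on {1..n - 1} (?H x) (?H y) =
      inner_on ?I x y - (\<Sum>i=1..n. x i) * (\<Sum>i=1..n. y i) / real n" by simp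
  have "(\<Sum>i=1..n. (x i - mean n x) * (y i - mean n y)) =
      (\<Sum>i=1..n. x i * y i) - mean n y * (\<Sum>i=1..n. x i) - mean n x * (\<Sum>i=1..n. y i) + real n * (mean n x * mean n y)"
    by (simp add: algebra_simps sum.distrib sum_subtractf sum_distrib_left)
  also have "\<dots> = inner_on ?I x y - (\<Sum>i=1..n. x i) * (\<Sum>i=1..n. y i) / real n"
    using n by (simp add: mean_def inner_on_def field_simps)
  finally show ?thesis using 1 by simp
qed

lemma pearson_centering:
  assumes "n \<ge> 1"
  shows "pearson n x y = inner_on {1..n - 1} (centering n x) (centering n y) /
    sqrt (inner_on {1..n - 1} (centering n x) (centering n x) * inner_on {1..n - 1} (centering n y) (centering n y))"
  unfolding inner_on_centering[OF assms] pearson_def by (simp add: power2_eq_square)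

lemma pearson_commute: "pearson n x y = pearson n y x"
  by (simp add: pearson_def mult.commute)

lemma divide_le_one_of_abs: "a \<le> s \<Longrightarrow> 0 \<le> a \<Longrightarrow> a / \<bar>s\<bar> \<le> (1 :: real)"
  using divide_le_eq_1_pos[of s a] by (cases "s = 0") simp_all

lemma abs_pearson_le_1:
  assumes "n \<ge> 1"
  shows "\<bar>pearson n x y\<bar> \<le> 1"
proof -
  let ?i = "inner_on {1..n - 1}"
  have "\<bar>?i u v\<bar> / \<bar>sqrt (?i u u * ?i v v)\<bar> \<le> 1" for u v
  proof -
    have "\<bar>?i u v\<bar> \<le> sqrt (?i u u * ?i v v)"
      using inner_on_Cauchy_Schwarz[of "{1..n - 1}" u v] by (intro real_le_rsqrt) simp
    then show ?thesis
      by (rule divide_le_one_of_abs) simp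
  qed
  then show ?thesis unfolding pearson_centering[OF assms] abs_divide .
qed

lemma pearson_ge_iff_in_cone:
  fixes x y :: "nat \<Rightarrow> real"
  assumes "n \<ge> 1"
    and "inner_on {1..n - 1} (centering n x) (centering n x) > 0"
    and "inner_on {1..n - 1} (centering n y) (centering n y) > 0"
  shows "s \<le> (pearson n x y)\<^sup>2 \<longleftrightarrow> in_cone {1..n - 1} s (centering n x) (centering n y)"
  unfolding pearson_centering[OF assms(1)] in_cone_def using assms(2,3)
  by (simp add: power_divide pos_le_divide_eq)

text \<open>
  In the coordinates of \<^const>\<open>centering\<close>, the first \<open>n - 1\<close> coordinates of \<open>Y\<close> have a spherical law on
  \<open>R\<^sup>n\<^sup>-\<^sup>1\<close>, and the Pearson correlation is their cosine, up to vectors whose first \<open>n - 1\<close>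
  coordinates vanish. Such vectors form the last axis, which is a cone of opening 0 and therefore
  has probability \<open>cap_fraction n 0 = 0\<close>.
\<close>

lemma spherical_pearson_cap:
  assumes n: "n \<ge> 3" and "prob_space M" and sph: "spherical M n Y"
    and nz: "measure M {\<omega> \<in> space M. \<forall>k\<in>{1..n}. Y \<omega> k = 0} = 0"
  defines "\<mu> \<equiv> distr M (Rn n) Y"
  shows "AE x in \<mu>. measure \<mu> {y \<in> space (Rn n). 1 - \<delta> \<le> (pearson n x y)\<^sup>2} = cap_fraction (n - 1) \<delta>"
proof -
  interpret M: prob_space M by fact
  let ?I = "{1..n}" and ?J = "{1..n - 1}"
  let ?H = "centering n"
  let ?PJ = "PiM ?J (\<lambda>_. borel) :: (nat \<Rightarrow> real) measure"
  have Y[measurable]: "Y \<in> measurable M (Rn n)" using sph by (simp add: spherical_def)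
  interpret mu: prob_space \<mu> unfolding \<mu>_def by (rule M.prob_space_distr[OF Y])
  have inv: "reflection_invariant ?I \<mu>"
    unfolding \<mu>_def by (rule spherical_reflection_invariant[OF sph])
  have sets[measurable_cong]: "sets \<mu> = sets (PiM ?I (\<lambda>_. borel))" by (simp add: \<mu>_def Rn_def)
  have sp: "space \<mu> = space (Rn n)" by (simp add: \<mu>_def)
  have null: "emeasure \<mu> {y \<in> space \<mu>. inner_on ?I y y = 0} = 0"
  proof -
    have "{y \<in> space \<mu>. inner_on ?I y y = 0} \<in> sets \<mu>" by measurable
    then have S: "{y \<in> space (Rn n). inner_on ?I y y = 0} \<in> sets (Rn n)" by (simp add: \<mu>_def)
    have "emeasure \<mu> {y \<in> space \<mu>. inner_on ?I y y = 0} =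
        emeasure M (Y -` {y \<in> space (Rn n). inner_on ?I y y = 0} \<inter> space M)"
      unfolding \<mu>_def space_distr by (rule emeasure_distr[OF Y S])
    also have "Y -` {y \<in> space (Rn n). inner_on ?I y y = 0} \<inter> space M =
        {\<omega> \<in> space M. \<forall>k\<in>?I. Y \<omega> k = 0}"
      using measurable_space[OF Y] by (auto simp: inner_on_self_eq_0_iff)
    finally show ?thesis using nz by (simp add: M.emeasure_eq_measure)
  qed
  \<comment> \<open>The vectors with vanishing first coordinates form the cone of opening 0 around the last axis.\<close>
  have axis: "emeasure \<mu> {y \<in> space \<mu>. inner_on ?J y y = 0} = 0"
  proof -
    let ?e = "\<lambda>i. if i = n then 1 else 0 :: real"
    have e: "inner_on ?I ?e y = y n" for y
      using inner_on_unit[of ?I n y] n by (simp add: inner_on_commute)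
    have "measure \<mu> {y \<in> space \<mu>. in_cone ?I (1 - 0) ?e y} = cap_fraction n 0"
      by (rule cone_measure_eq_cap_fraction[OF _ inv mu.prob_space_axioms null]) (use n e in auto)
    then have z: "emeasure \<mu> {y \<in> space \<mu>. in_cone ?I 1 ?e y} = 0"
      using n by (simp add: cap_fraction_0 mu.emeasure_eq_measure)
    have split: "inner_on ?I y y = (y n)\<^sup>2 + inner_on ?J y y" for y
    proof -
      have I: "?I = insert n ?J" using n by auto
      show ?thesis unfolding I inner_on_def using n by (subst sum.insert) (auto simp: power2_eq_square)
    qed
    have "in_cone ?I 1 ?e y" if "inner_on ?J y y = 0" for y
      unfolding in_cone_def e using split[of y] that by simp
    then have "{y \<in> space \<mu>. inner_on ?J y y = 0} \<subseteq> {y \<in> space \<mu>. in_cone ?I 1 ?e y}"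
      by auto
    moreover have "{y \<in> space \<mu>. in_cone ?I 1 ?e y} \<in> sets \<mu>" unfolding in_cone_def by measurable
    ultimately show ?thesis using emeasure_eq_0[OF _ z] by blast
  qed
  define \<nu> where "\<nu> = distr \<mu> ?PJ (\<lambda>y. restrict y ?J)"
  have r: "(\<lambda>y. restrict y ?J) \<in> measurable (PiM ?I (\<lambda>_. borel)) ?PJ"
    by (intro measurable_restrict) auto
  then have r\<mu>: "(\<lambda>y. restrict y ?J) \<in> measurable \<mu> ?PJ"
    by (simp add: measurable_cong_sets[OF sets refl])
  have H: "?H \<in> measurable \<mu> (PiM ?I (\<lambda>_. borel))"
    unfolding centering_def using measurable_reflect by (simp add: measurable_cong_sets[OF sets refl])
  have \<nu>H: "\<nu> = distr \<mu> ?PJ (\<lambda>y. restrict (?H y) ?J)"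
  proof -
    have "\<nu> = distr (distr \<mu> (PiM ?I (\<lambda>_. borel)) ?H) ?PJ (\<lambda>y. restrict y ?J)"
      using inv by (simp add: \<nu>_def reflection_invariant_def centering_def)
    also have "\<dots> = distr \<mu> ?PJ ((\<lambda>y. restrict y ?J) \<circ> ?H)"
      by (rule distr_distr[OF r H])
    finally show ?thesis by (simp add: comp_def)
  qed
  have rH: "(\<lambda>y. restrict (?H y) ?J) \<in> measurable \<mu> ?PJ"
    using measurable_compose[OF H r] .
  interpret nu: prob_space \<nu> unfolding \<nu>_def by (rule mu.prob_space_distr[OF r\<mu>])
  have inv\<nu>: "reflection_invariant ?J \<nu>"
    unfolding \<nu>_def by (rule reflection_invariant_restrict[OF _ _ inv]) auto
  have sets\<nu>[measurable_cong]: "sets \<nu> = sets ?PJ" by (simp add: \<nu>_def)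
  have null\<nu>: "emeasure \<nu> {z \<in> space \<nu>. inner_on ?J z z = 0} = 0"
  proof -
    have S: "{z \<in> space ?PJ. inner_on ?J z z = 0} \<in> sets ?PJ" by measurable
    have "emeasure \<nu> {z \<in> space \<nu>. inner_on ?J z z = 0} =
        emeasure \<mu> ((\<lambda>y. restrict y ?J) -` {z \<in> space ?PJ. inner_on ?J z z = 0} \<inter> space \<mu>)"
      unfolding \<nu>_def space_distr by (rule emeasure_distr[OF r\<mu> S])
    also have "(\<lambda>y. restrict y ?J) -` {z \<in> space ?PJ. inner_on ?J z z = 0} \<inter> space \<mu> =
        {y \<in> space \<mu>. inner_on ?J y y = 0}"
      by (auto simp: space_PiM)
    finally show ?thesis using axis by simp
  qed
  have "AE z in \<nu>. inner_on ?J z z > 0"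
    by (rule AE_I[OF _ null\<nu>]) (auto simp: less_le)
  then have nondeg: "AE y in \<mu>. inner_on ?J (?H y) (?H y) > 0"
    using AE_distrD[OF rH, of "\<lambda>z. inner_on ?J z z > 0"] unfolding \<nu>H by simp
  show ?thesis
    using nondeg
  proof eventually_elim
    case (elim x)
    note x = this
    let ?C = "{z \<in> space ?PJ. in_cone ?J (1 - \<delta>) (?H x) z}"
    have C: "?C \<in> sets ?PJ" unfolding in_cone_def by measurable
    have cone: "{y \<in> space \<mu>. in_cone ?J (1 - \<delta>) (?H x) (?H y)} = (\<lambda>y. restrict (?H y) ?J) -` ?C \<inter> space \<mu>"
      by (auto simp: space_PiM in_cone_def)
    have "measure \<mu> {y \<in> space (Rn n). 1 - \<delta> \<le> (pearson n x y)\<^sup>2} =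
        measure \<mu> {y \<in> space \<mu>. in_cone ?J (1 - \<delta>) (?H x) (?H y)}"
    proof (rule measure_eq_AE)
      show "AE y in \<mu>. y \<in> {y \<in> space (Rn n). 1 - \<delta> \<le> (pearson n x y)\<^sup>2} \<longleftrightarrow>
          y \<in> {y \<in> space \<mu>. in_cone ?J (1 - \<delta>) (?H x) (?H y)}"
        using nondeg
      proof eventually_elim
        case (elim y)
        from pearson_ge_iff_in_cone[OF _ x this, of "1 - \<delta>"] n show ?case by (simp add: sp)
      qed
      show "{y \<in> space \<mu>. in_cone ?J (1 - \<delta>) (?H x) (?H y)} \<in> sets \<mu>"
        unfolding cone by (rule measurable_sets[OF rH C])
      have [measurable]: "(\<lambda>y. y i) \<in> borel_measurable \<mu>" if "i \<in> {1..n}" for i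
        using that by (simp add: measurable_cong_sets[OF sets refl])
      have [measurable]: "(\<lambda>y. pearson n x y) \<in> borel_measurable \<mu>"
        unfolding pearson_def mean_def by measurable
      have "{y \<in> space \<mu>. 1 - \<delta> \<le> (pearson n x y)\<^sup>2} \<in> sets \<mu>" by measurable
      then show "{y \<in> space (Rn n). 1 - \<delta> \<le> (pearson n x y)\<^sup>2} \<in> sets \<mu>" by (simp add: sp)
    qed
    also have "\<dots> = measure \<nu> ?C"
      unfolding \<nu>H cone by (rule measure_distr[OF rH C, symmetric])
    also have "?C = {z \<in> space \<nu>. in_cone ?J (1 - \<delta>) (?H x) z}"
      by (simp add: \<nu>_def)
    also have "measure \<nu> \<dots> = cap_fraction (n - 1) \<delta>"
      by (rule cone_measure_eq_cap_fraction[OF _ inv\<nu> nu.prob_space_axioms null\<nu> elim]) (use n in auto)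
    finally show ?case .
  qed
qed

section \<open>Avoiding related pairs in an independent sample\<close>

text \<open>
  A crude form of the second Bonferroni inequality, with the sum over ordered pairs.
\<close>

lemma (in finite_measure) bonferroni_uniform:
  assumes "finite I" and "\<And>i. i \<in> I \<Longrightarrow> B i \<in> sets M"
    and "\<And>i j. i \<in> I \<Longrightarrow> j \<in> I \<Longrightarrow> i \<noteq> j \<Longrightarrow> measure M (B i \<inter> B j) \<le> r" and "r \<ge> 0"
  shows "(\<Sum>i\<in>I. measure M (B i)) \<le> measure M (\<Union>i\<in>I. B i) + real (card I) ^ 2 * r"
  using assms(1-3)
proof (induction I rule: finite_induct)
  case empty
  then show ?case by simp
next
  case (insert k I)
  let ?U = "\<Union>i\<in>I. B i"
  have U: "?U \<in> sets M" using insert by auto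
  have "B k \<inter> ?U = (\<Union>i\<in>I. B k \<inter> B i)" by auto
  also have "measure M \<dots> \<le> (\<Sum>i\<in>I. measure M (B k \<inter> B i))"
    using insert by (intro finite_measure_subadditive_finite) auto
  also have "\<dots> \<le> (\<Sum>i\<in>I. r)"
    using insert by (intro sum_mono) auto
  finally have 1: "measure M (B k \<inter> ?U) \<le> real (card I) * r" by simp
  have "measure M (B k \<union> ?U) = measure M (B k) + measure M ?U - measure M (B k \<inter> ?U)"
    using insert U by (intro measure_Un3) (auto simp: fmeasurable_eq_sets)
  moreover have "(\<Sum>i\<in>I. measure M (B i)) \<le> measure M ?U + real (card I) ^ 2 * r"
    using insert by auto
  moreover have "real (card I) ^ 2 * r + real (card I) * r \<le> real (card (insert k I)) ^ 2 * r"
    using insert \<open>r \<ge> 0\<close>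
    by (simp add: power2_eq_square algebra_simps)
  ultimately show ?case using 1 insert by simp
qed

lemma (in finite_measure) measure_eq_of_emeasure:
  "emeasure M A = ennreal q * emeasure M B \<Longrightarrow> 0 \<le> q \<Longrightarrow> measure M A = measure M B * q"
  by (simp add: emeasure_eq_measure ennreal_mult[symmetric] mult.commute)

text \<open>
  Condition on the observations in \<open>A\<close>: whatever they are, the new observation \<open>X j\<close> is related to
  \<open>X i\<close> with probability \<open>q\<close>. So this event is independent of everything that is known about \<open>A\<close>.
\<close>

lemma (in prob_space) prob_fresh_hit:
  assumes ind: "indep_vars (\<lambda>_. S) X I"
    and law: "\<And>i. i \<in> I \<Longrightarrow> distr M S (X i) = \<mu>"
    and R: "Measurable.pred (S \<Otimes>\<^sub>M S) (\<lambda>z. R (fst z) (snd z))"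
    and q: "AE x in \<mu>. measure \<mu> {y \<in> space S. R x y} = q"
    and A: "A \<subseteq> I" "i \<in> A" "j \<in> I" "j \<notin> A"
    and E: "E \<in> sets (PiM A (\<lambda>_. S))"
  shows "prob {\<omega> \<in> space M. restrict (\<lambda>i. X i \<omega>) A \<in> E \<and> R (X i \<omega>) (X j \<omega>)} =
         prob {\<omega> \<in> space M. restrict (\<lambda>i. X i \<omega>) A \<in> E} * q"
proof -
  let ?P = "PiM A (\<lambda>_. S)"
  let ?U = "\<lambda>\<omega>. restrict (\<lambda>i. X i \<omega>) A"
  let ?S = "PiM {j} (\<lambda>_. S)"
  let ?V = "\<lambda>\<omega>. restrict (\<lambda>i. X i \<omega>) {j}"
  have X: "random_variable S (X k)" if "k \<in> I" for k
    using ind that by (auto simp: indep_vars_def)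
  have U[measurable]: "random_variable ?P ?U"
    using X A by (intro measurable_restrict) auto
  have V[measurable]: "random_variable ?S ?V"
    using X A by (intro measurable_restrict) auto
  have [measurable]: "random_variable S (X j)" "random_variable S (X i)" using X A by auto
  have "indep_var ?P ?U ?S ?V"
    using A by (intro indep_var_restrict[OF ind]) auto
  then have prod: "distr M ?P ?U \<Otimes>\<^sub>M distr M ?S ?V = distr M (?P \<Otimes>\<^sub>M ?S) (\<lambda>\<omega>. (?U \<omega>, ?V \<omega>))"
    by (simp add: indep_var_distribution_eq)
  have sets_mu[measurable_cong]: "sets \<mu> = sets S" and sp_mu: "space \<mu> = space S"
    using law[OF A(3)] by auto
  interpret mu: prob_space \<mu> using law[OF A(3)] prob_space_distr[of "X j" S] by simp
  interpret U: prob_space "distr M ?P ?U" by (rule prob_space_distr) fact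
  interpret V: prob_space "distr M ?S ?V" by (rule prob_space_distr) fact
  \<comment> \<open>The observation outside \<open>A\<close> enters as a one-element family, because both components of an independent pair must have the same type.\<close>
  define W where "W = {z \<in> space (?P \<Otimes>\<^sub>M ?S). fst z \<in> E \<and> R (fst z i) (snd z j)}"
  have comp[measurable]: "(\<lambda>u. u i) \<in> measurable ?P S" using A by (intro measurable_component_singleton)
  have R': "Measurable.pred L (\<lambda>\<omega>. R (f \<omega>) (g \<omega>))"
    if "f \<in> measurable L S" "g \<in> measurable L S" for L f g
    using measurable_compose[OF measurable_Pair[OF that] R] by simp
  have W[measurable]: "W \<in> sets (?P \<Otimes>\<^sub>M ?S)"
  proof -
    have [measurable]: "Measurable.pred (?P \<Otimes>\<^sub>M ?S) (\<lambda>z. R (fst z i) (snd z j))"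
      by (rule R') measurable
    have [measurable]: "E \<in> sets ?P" by fact
    show ?thesis unfolding W_def by measurable
  qed
  have law_i: "distr (distr M ?P ?U) S (\<lambda>u. u i) = \<mu>"
  proof -
    have "distr (distr M ?P ?U) S (\<lambda>u. u i) = distr M S ((\<lambda>u. u i) \<circ> ?U)"
      by (rule distr_distr) measurable
    also have "(\<lambda>u. u i) \<circ> ?U = X i" using A by (auto simp: fun_eq_iff)
    also have "distr M S (X i) = \<mu>" using A by (intro law) auto
    finally show ?thesis .
  qed
  have law_j: "distr (distr M ?S ?V) S (\<lambda>v. v j) = \<mu>"
  proof -
    have "distr (distr M ?S ?V) S (\<lambda>v. v j) = distr M S ((\<lambda>v. v j) \<circ> ?V)"
      by (rule distr_distr) measurable
    also have "(\<lambda>v. v j) \<circ> ?V = X j" by (auto simp: fun_eq_iff)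
    also have "distr M S (X j) = \<mu>" using A by (intro law) auto
    finally show ?thesis .
  qed
  have slice: "emeasure (distr M ?S ?V) {v \<in> space ?S. R x (v j)} = emeasure \<mu> {y \<in> space S. R x y}"
    if x: "x \<in> space S" for x
  proof -
    have "Measurable.pred S (\<lambda>y. R x y)" using x by (intro R') measurable
    then have Rx: "{y \<in> space S. R x y} \<in> sets S" by (rule predE)
    have comp_j: "(\<lambda>v. v j) \<in> measurable (distr M ?S ?V) S"
      using measurable_component_singleton[of j "{j}" "\<lambda>_. S"] by simp
    have "emeasure \<mu> {y \<in> space S. R x y} = emeasure (distr (distr M ?S ?V) S (\<lambda>v. v j)) {y \<in> space S. R x y}"
      by (simp only: law_j)
    also have "\<dots> = emeasure (distr M ?S ?V) ((\<lambda>v. v j) -` {y \<in> space S. R x y} \<inter> space (distr M ?S ?V))"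
      by (rule emeasure_distr[OF comp_j Rx])
    also have "(\<lambda>v. v j) -` {y \<in> space S. R x y} \<inter> space (distr M ?S ?V) = {v \<in> space ?S. R x (v j)}"
      by (auto simp: space_PiM)
    finally show ?thesis by (rule sym)
  qed
  have q0: "q \<ge> 0"
  proof -
    have "AE x in \<mu>. q \<ge> 0" using q by eventually_elim (metis measure_nonneg)
    then show ?thesis by simp
  qed
  have AEU: "AE u in distr M ?P ?U. measure \<mu> {y \<in> space S. R (u i) y} = q"
    using AE_distrD[of "\<lambda>u. u i" "distr M ?P ?U" S] q unfolding law_i by simp
  have "emeasure M {\<omega> \<in> space M. ?U \<omega> \<in> E \<and> R (X i \<omega>) (X j \<omega>)} =
        emeasure (distr M (?P \<Otimes>\<^sub>M ?S) (\<lambda>\<omega>. (?U \<omega>, ?V \<omega>))) W"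
  proof (subst emeasure_distr)
    have "?U \<omega> \<in> space ?P" "?V \<omega> \<in> space ?S" if "\<omega> \<in> space M" for \<omega>
      using measurable_space[OF U that] measurable_space[OF V that] by auto
    then have "{\<omega> \<in> space M. ?U \<omega> \<in> E \<and> R (X i \<omega>) (X j \<omega>)} = (\<lambda>\<omega>. (?U \<omega>, ?V \<omega>)) -` W \<inter> space M"
      using A by (auto simp: W_def space_pair_measure)
    then show "emeasure M {\<omega> \<in> space M. ?U \<omega> \<in> E \<and> R (X i \<omega>) (X j \<omega>)} =
        emeasure M ((\<lambda>\<omega>. (?U \<omega>, ?V \<omega>)) -` W \<inter> space M)" by simp
  qed measurable
  also have "\<dots> = emeasure (distr M ?P ?U \<Otimes>\<^sub>M distr M ?S ?V) W" by (simp add: prod)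
  also have "\<dots> = (\<integral>\<^sup>+ u. emeasure (distr M ?S ?V) (Pair u -` W) \<partial>distr M ?P ?U)"
    by (rule V.emeasure_pair_measure_alt) measurable
  also have "\<dots> = (\<integral>\<^sup>+ u. ennreal q * indicator E u \<partial>distr M ?P ?U)"
  proof (rule nn_integral_cong_AE, use AEU AE_space in eventually_elim)
    case (elim u)
    then have "Pair u -` W = (if u \<in> E then {v \<in> space ?S. R (u i) (v j)} else {})"
      by (auto simp: W_def space_pair_measure)
    moreover have "u i \<in> space S" using elim A by (auto simp: space_PiM)
    ultimately show ?case using elim by (simp add: mu.emeasure_eq_measure slice)
  qed
  also have "\<dots> = ennreal q * emeasure (distr M ?P ?U) E"
    using E by (simp add: nn_integral_cmult_indicator)
  also have "emeasure (distr M ?P ?U) E = emeasure M {\<omega> \<in> space M. ?U \<omega> \<in> E}"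
    using E by (subst emeasure_distr) (auto simp: vimage_def Int_def conj_commute)
  finally show ?thesis using q0 by (rule measure_eq_of_emeasure)
qed

lemma exp_minus_bounds:
  fixes x :: real
  assumes "0 \<le> x"
  shows "1 - x \<le> exp (- x)" "exp (- x) \<le> 1 - x + x\<^sup>2"
proof -
  show "1 - x \<le> exp (- x)" using exp_ge_add_one_self[of "- x"] by simp
  have "1 \<le> (1 - x + x\<^sup>2) * (1 + x)"
    using assms by (simp add: algebra_simps power2_eq_square)
  also have "\<dots> \<le> (1 - x + x\<^sup>2) * exp x"
  proof (rule mult_left_mono)
    have "0 \<le> (x - 1/2)\<^sup>2 + 3/4" by simp
    then show "0 \<le> 1 - x + x\<^sup>2" by (simp add: power2_eq_square algebra_simps)
  qed simp
  finally show "exp (- x) \<le> 1 - x + x\<^sup>2" by (simp add: exp_minus field_simps)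
qed

text \<open>
  If \<open>a' = a (1 - x)\<close> up to an error \<open>x\<^sup>2\<close>, then \<open>a\<close> stays as close to the exponential as before, up
  to another \<open>x\<^sup>2\<close>, since \<open>1 - x\<close> and \<open>exp (- x)\<close> differ by at most \<open>x\<^sup>2\<close>. The map contracts the old error.
\<close>

lemma exp_recursion_step:
  fixes a a' e x b :: real
  assumes "0 \<le> x" "x \<le> 1" "0 \<le> e" "e \<le> 1" "\<bar>a - e\<bar> \<le> b"
    and "a * (1 - x) \<le> a'" "a' \<le> a * (1 - x) + x\<^sup>2"
  shows "\<bar>a' - e * exp (- x)\<bar> \<le> b + x\<^sup>2"
proof -
  have "(1 - x) * \<bar>a - e\<bar> \<le> 1 * b"
    using assms by (intro mult_mono) auto
  then have d: "\<bar>a * (1 - x) - e * (1 - x)\<bar> \<le> b"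
  proof -
    have "a * (1 - x) - e * (1 - x) = (1 - x) * (a - e)" by (simp add: algebra_simps)
    then show ?thesis using \<open>(1 - x) * \<bar>a - e\<bar> \<le> 1 * b\<close> assms by (simp add: abs_mult)
  qed
  have "e * (1 - x) \<le> e * exp (- x)" "e * exp (- x) \<le> e * (1 - x + x\<^sup>2)"
    using exp_minus_bounds[OF assms(1)] assms by (auto intro: mult_left_mono)
  moreover have "e * (1 - x + x\<^sup>2) \<le> e * (1 - x) + x\<^sup>2"
    using assms by (simp add: algebra_simps mult_left_le_one_le)
  ultimately show ?thesis using d assms by linarith
qed

text \<open>
  By induction on the number \<open>k\<close> of observations. Let \<open>N k\<close> be the event that there is no related pair
  among the first \<open>k\<close>. The step from \<open>N k\<close> to \<open>N (k + 1)\<close> removes the events \<open>A i\<close> that the new point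
  is related to \<open>X i\<close>. Each \<open>A i\<close> is independent of \<open>N k\<close>, and two of them meet with probability \<open>q\<^sup>2\<close>
  (condition on the new point and use the symmetry of the relation), so
  \<open>P(N (k + 1)) = P(N k) (1 - k q) + O(k\<^sup>2 q\<^sup>2)\<close>.
\<close>

lemma (in prob_space) prob_no_related_pair:
  fixes X :: "nat \<Rightarrow> 'a \<Rightarrow> 'b"
  assumes ind: "indep_vars (\<lambda>_. S) X {1..p}"
    and law: "\<And>i. i \<in> {1..p} \<Longrightarrow> distr M S (X i) = \<mu>"
    and R: "Measurable.pred (S \<Otimes>\<^sub>M S) (\<lambda>z. R (fst z) (snd z))"
    and sym: "\<And>x y. R x y \<longleftrightarrow> R y x"
    and q: "AE x in \<mu>. measure \<mu> {y \<in> space S. R x y} = q"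
    and pq: "real p * q \<le> 1" and q0: "q \<ge> 0"
  shows "\<bar>prob {\<omega> \<in> space M. \<forall>i\<in>{1..p}. \<forall>j\<in>{1..p}. i < j \<longrightarrow> \<not> R (X i \<omega>) (X j \<omega>)}
          - exp (- (q * (real p * (real p - 1) / 2)))\<bar> \<le> real p ^ 3 * q\<^sup>2"
proof -
  define N where "N k = {\<omega> \<in> space M. \<forall>i\<in>{1..k}. \<forall>j\<in>{1..k}. i < j \<longrightarrow> \<not> R (X i \<omega>) (X j \<omega>)}" for k :: nat
  have X[measurable]: "random_variable S (X k)" if "k \<in> {1..p}" for k
    using ind that by (auto simp: indep_vars_def)
  have R': "Measurable.pred L (\<lambda>\<omega>. R (f \<omega>) (g \<omega>))"
    if "f \<in> measurable L S" "g \<in> measurable L S" for L f g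
    using measurable_compose[OF measurable_Pair[OF that] R] by simp
  have "\<bar>prob (N k) - exp (- (q * (real k * (real k - 1) / 2)))\<bar> \<le> real k ^ 3 * q\<^sup>2" if "k \<le> p" for k
    using that
  proof (induction k)
    case 0
    have "N 0 = space M" by (simp add: N_def)
    then show ?case by (simp add: prob_space)
  next
    case (Suc k)
    let ?P = "PiM {1..k} (\<lambda>_. S)"
    define A where "A i = {\<omega> \<in> space M. R (X i \<omega>) (X (Suc k) \<omega>)}" for i
    define E where "E = {u \<in> space ?P. \<forall>i\<in>{1..k}. \<forall>j\<in>{1..k}. i < j \<longrightarrow> \<not> R (u i) (u j)}"
    have E: "E \<in> sets ?P"
    proof -
      have [measurable]: "Measurable.pred ?P (\<lambda>u. R (u i) (u j))" if "i \<in> {1..k}" "j \<in> {1..k}" for i j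
        using that by (intro R' measurable_component_singleton)
      show ?thesis unfolding E_def by measurable
    qed
    have U: "restrict (\<lambda>i. X i \<omega>) {1..k} \<in> space ?P" if "\<omega> \<in> space M" for \<omega>
      using measurable_space[OF X that] Suc.prems by (auto simp: space_PiM)
    have N_E: "N k = {\<omega> \<in> space M. restrict (\<lambda>i. X i \<omega>) {1..k} \<in> E}"
      using U by (auto simp: N_def E_def)
    have [measurable]: "N k \<in> events"
    proof -
      have "(\<lambda>\<omega>. restrict (\<lambda>i. X i \<omega>) {1..k}) \<in> measurable M ?P"
        using Suc.prems by (intro measurable_restrict X) auto
      from measurable_sets[OF this E] show ?thesis
        unfolding N_E by (simp add: vimage_def Int_def conj_commute)
    qed
    have A[measurable]: "A i \<in> events" if "i \<in> {1..k}" for i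
    proof -
      have [measurable]: "Measurable.pred M (\<lambda>\<omega>. R (X i \<omega>) (X (Suc k) \<omega>))"
        using that Suc.prems by (intro R' X) auto
      show ?thesis unfolding A_def by measurable
    qed
    have hit: "prob (N k \<inter> A i) = prob (N k) * q" if i: "i \<in> {1..k}" for i
    proof -
      have "N k \<inter> A i = {\<omega> \<in> space M. restrict (\<lambda>i. X i \<omega>) {1..k} \<in> E \<and> R (X i \<omega>) (X (Suc k) \<omega>)}"
        unfolding N_E A_def by auto
      also have "prob \<dots> = prob (N k) * q"
        unfolding N_E using i Suc.prems by (intro prob_fresh_hit[OF ind law R q _ _ _ _ E]) auto
      finally show ?thesis .
    qed
    have single: "prob (A i) = q" if i: "i \<in> {1..k}" for i
    proof -
      have "restrict (\<lambda>i. X i \<omega>) {i} \<in> space (PiM {i} (\<lambda>_. S))" if "\<omega> \<in> space M" for \<omega>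
        using measurable_space[OF X that, of i] i Suc.prems by (auto simp: space_PiM)
      then have eq: "{\<omega> \<in> space M. restrict (\<lambda>i. X i \<omega>) {i} \<in> space (PiM {i} (\<lambda>_. S))} = space M"
        "A i = {\<omega> \<in> space M. restrict (\<lambda>i. X i \<omega>) {i} \<in> space (PiM {i} (\<lambda>_. S)) \<and> R (X i \<omega>) (X (Suc k) \<omega>)}"
        by (auto simp: A_def)
      have "prob (A i) = prob {\<omega> \<in> space M. restrict (\<lambda>i. X i \<omega>) {i} \<in> space (PiM {i} (\<lambda>_. S))} * q"
        unfolding eq(2) using i Suc.prems by (intro prob_fresh_hit[OF ind law R q _ _ _ _ sets.top]) auto
      then show ?thesis unfolding eq(1) by (simp add: prob_space)
    qed
    have pair: "prob (A i \<inter> A j) = q\<^sup>2" if i: "i \<in> {1..k}" and j: "j \<in> {1..k}" and ij: "i \<noteq> j" for i j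
    proof -
      let ?J = "{i, Suc k}"
      let ?Q = "PiM ?J (\<lambda>_. S)"
      let ?E = "{u \<in> space ?Q. R (u i) (u (Suc k))}"
      have E': "?E \<in> sets ?Q"
      proof -
        have [measurable]: "Measurable.pred ?Q (\<lambda>u. R (u i) (u (Suc k)))"
          by (intro R' measurable_component_singleton) auto
        show ?thesis by measurable
      qed
      have "restrict (\<lambda>i. X i \<omega>) ?J \<in> space ?Q" if "\<omega> \<in> space M" for \<omega>
        using measurable_space[OF X that] i Suc.prems by (auto simp: space_PiM)
      then have eq: "A i = {\<omega> \<in> space M. restrict (\<lambda>i. X i \<omega>) ?J \<in> ?E}"
        "A i \<inter> A j = {\<omega> \<in> space M. restrict (\<lambda>i. X i \<omega>) ?J \<in> ?E \<and> R (X (Suc k) \<omega>) (X j \<omega>)}"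
        using sym by (auto simp: A_def)
      have "prob (A i \<inter> A j) = prob (A i) * q"
        unfolding eq(2) unfolding eq(1)
        using i j ij Suc.prems by (intro prob_fresh_hit[OF ind law R q _ _ _ _ E']) auto
      then show ?thesis using single[OF i] by (simp add: power2_eq_square)
    qed
    let ?B = "\<lambda>i. N k \<inter> A i"
    have "N (Suc k) = N k - (\<Union>i\<in>{1..k}. ?B i)"
    proof -
      have "{1..Suc k} = insert (Suc k) {1..k}" by auto
      then show ?thesis by (auto simp: N_def A_def)
    qed
    moreover have "(\<Union>i\<in>{1..k}. ?B i) \<in> events" by (intro sets.finite_UN) auto
    ultimately have rec: "prob (N (Suc k)) = prob (N k) - prob (\<Union>i\<in>{1..k}. ?B i)"
      by (simp, intro finite_measure_Diff) auto
    have sumB: "(\<Sum>i\<in>{1..k}. prob (?B i)) = real k * q * prob (N k)"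
      using hit by (simp add: mult_ac)
    have le: "prob (\<Union>i\<in>{1..k}. ?B i) \<le> real k * q * prob (N k)"
      unfolding sumB[symmetric] by (intro finite_measure_subadditive_finite) auto
    have ge: "real k * q * prob (N k) \<le> prob (\<Union>i\<in>{1..k}. ?B i) + (real k * q)\<^sup>2"
    proof -
      have "(\<Sum>i\<in>{1..k}. prob (?B i)) \<le> prob (\<Union>i\<in>{1..k}. ?B i) + real (card {1..k}) ^ 2 * q\<^sup>2"
      proof (rule bonferroni_uniform)
        fix i j assume ij: "i \<in> {1..k}" "j \<in> {1..k}" "i \<noteq> j"
        then have "prob (?B i \<inter> ?B j) \<le> prob (A i \<inter> A j)"
          by (intro finite_measure_mono) auto
        then show "prob (?B i \<inter> ?B j) \<le> q\<^sup>2" using pair ij by simp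
      qed auto
      then show ?thesis unfolding sumB by (simp add: power_mult_distrib)
    qed
    let ?e = "exp (- (q * (real k * (real k - 1) / 2)))"
    have kq: "real k * q \<le> 1"
    proof -
      have "real k * q \<le> real p * q" using Suc.prems q0 by (intro mult_right_mono) auto
      then show ?thesis using pq by simp
    qed
    have "real k * (real k - 1) \<ge> 0" by (cases k) auto
    then have e1: "?e \<le> 1" using q0 by simp
    have "\<bar>prob (N (Suc k)) - ?e * exp (- (real k * q))\<bar> \<le> real k ^ 3 * q\<^sup>2 + (real k * q)\<^sup>2"
    proof (rule exp_recursion_step)
      show "\<bar>prob (N k) - ?e\<bar> \<le> real k ^ 3 * q\<^sup>2" using Suc by simp
      show "prob (N k) * (1 - real k * q) \<le> prob (N (Suc k))"
        using rec le by (simp add: algebra_simps)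
      show "prob (N (Suc k)) \<le> prob (N k) * (1 - real k * q) + (real k * q)\<^sup>2"
        using rec ge by (simp add: algebra_simps)
    qed (use kq q0 e1 in auto)
    also have "?e * exp (- (real k * q)) = exp (- (q * (real (Suc k) * (real (Suc k) - 1) / 2)))"
      by (simp add: field_simps flip: exp_add)
    also have "real k ^ 3 * q\<^sup>2 + (real k * q)\<^sup>2 \<le> real (Suc k) ^ 3 * q\<^sup>2"
    proof -
      have "real k ^ 3 + real k ^ 2 \<le> real (Suc k) ^ 3"
        by (simp add: power3_eq_cube power2_eq_square algebra_simps)
      from mult_right_mono[OF this, of "q\<^sup>2"] show ?thesis
        by (simp add: power_mult_distrib algebra_simps)
    qed
    finally show ?case .
  qed
  from this[OF order_refl] show ?thesis unfolding N_def .
qed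

text \<open>
  Here \<open>p\<^sup>2 q\<close> converges while \<open>p\<close> tends to infinity; so \<open>p q\<close> and the error term
  \<open>p\<^sup>3 q\<^sup>2 = (p\<^sup>2 q)\<^sup>2 / p\<close> tend to 0.
\<close>

lemma avoidance_limit:
  fixes p :: "nat \<Rightarrow> nat" and q a :: "nat \<Rightarrow> real"
  assumes P: "filterlim (\<lambda>n. real (p n)) at_top sequentially"
    and q: "(\<lambda>n. real (p n) ^ 2 * q n) \<longlonglongrightarrow> 2 * \<Lambda>"
    and bound: "\<forall>\<^sub>F n in sequentially. real (p n) * q n \<le> 1 \<longrightarrow>
      \<bar>a n - exp (- (q n * (real (p n) * (real (p n) - 1) / 2)))\<bar> \<le> real (p n) ^ 3 * (q n)\<^sup>2"
  shows "a \<longlonglongrightarrow> exp (- \<Lambda>)"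
proof -
  have inv: "(\<lambda>n. 1 / real (p n)) \<longlonglongrightarrow> 0"
    using filterlim_compose[OF tendsto_inverse_0_at_top[OF filterlim_ident] P] by (simp add: inverse_eq_divide)
  have nz: "\<forall>\<^sub>F n in sequentially. real (p n) > 0"
    using P by (simp only: filterlim_at_top_dense)
  have "(\<lambda>n. real (p n) ^ 2 * q n * (1 / real (p n))) \<longlonglongrightarrow> 2 * \<Lambda> * 0"
    by (intro tendsto_mult q inv)
  then have "\<forall>\<^sub>F n in sequentially. real (p n) ^ 2 * q n * (1 / real (p n)) < 1"
    by (intro order_tendstoD(2)) auto
  with nz have small: "\<forall>\<^sub>F n in sequentially. real (p n) * q n \<le> 1"
    by eventually_elim (simp add: power2_eq_square)
  have "(\<lambda>n. (real (p n) ^ 2 * q n)\<^sup>2 * (1 / real (p n))) \<longlonglongrightarrow> (2 * \<Lambda>)\<^sup>2 * 0"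
    by (intro tendsto_intros q inv)
  moreover have "\<forall>\<^sub>F n in sequentially. (real (p n) ^ 2 * q n)\<^sup>2 * (1 / real (p n)) = real (p n) ^ 3 * (q n)\<^sup>2"
    using nz by eventually_elim (simp add: power2_eq_square power3_eq_cube)
  ultimately have err: "(\<lambda>n. real (p n) ^ 3 * (q n)\<^sup>2) \<longlonglongrightarrow> 0"
    using Lim_transform_eventually by fastforce
  have "(\<lambda>n. exp (- (real (p n) ^ 2 * q n / 2 * (1 - 1 / real (p n))))) \<longlonglongrightarrow> exp (- (2 * \<Lambda> / 2 * (1 - 0)))"
    by (intro tendsto_intros q inv) simp
  moreover have "\<forall>\<^sub>F n in sequentially. exp (- (real (p n) ^ 2 * q n / 2 * (1 - 1 / real (p n)))) =
      exp (- (q n * (real (p n) * (real (p n) - 1) / 2)))"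
    using nz by eventually_elim (simp add: power2_eq_square field_simps)
  ultimately have "(\<lambda>n. exp (- (q n * (real (p n) * (real (p n) - 1) / 2)))) \<longlonglongrightarrow> exp (- (2 * \<Lambda> / 2 * (1 - 0)))"
    by (rule Lim_transform_eventually)
  then have main: "(\<lambda>n. exp (- (q n * (real (p n) * (real (p n) - 1) / 2)))) \<longlonglongrightarrow> exp (- \<Lambda>)" by simp
  have "(\<lambda>n. a n - exp (- (q n * (real (p n) * (real (p n) - 1) / 2)))) \<longlonglongrightarrow> 0"
  proof (rule Lim_null_comparison[OF _ err])
    show "\<forall>\<^sub>F n in sequentially. norm (a n - exp (- (q n * (real (p n) * (real (p n) - 1) / 2)))) \<le> real (p n) ^ 3 * (q n)\<^sup>2"
      using bound small by eventually_elim simp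
  qed
  from tendsto_add[OF this main] show ?thesis by simp
qed

section \<open>The coherence at a fixed dimension\<close>

lemma coherence_props:
  fixes x :: "nat \<Rightarrow> nat \<Rightarrow> real"
  assumes "p \<ge> 2"
  shows "\<exists>i j. 1 \<le> i \<and> i < j \<and> j \<le> p \<and> coherence n p x = \<bar>pearson n (x i) (x j)\<bar>"
    and "\<And>i j. 1 \<le> i \<Longrightarrow> i < j \<Longrightarrow> j \<le> p \<Longrightarrow> \<bar>pearson n (x i) (x j)\<bar> \<le> coherence n p x"
proof -
  let ?S = "{\<bar>pearson n (x i) (x j)\<bar> | i j. 1 \<le> i \<and> i < j \<and> j \<le> p}"
  have "?S \<subseteq> (\<lambda>(i, j). \<bar>pearson n (x i) (x j)\<bar>) ` ({1..p} \<times> {1..p})" by auto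
  then have fin: "finite ?S" by (rule finite_subset) simp
  have "\<bar>pearson n (x 1) (x 2)\<bar> \<in> ?S"
    by (rule CollectI, rule exI[of _ 1], rule exI[of _ 2]) (use assms in simp)
  then have "?S \<noteq> {}" by blast
  from Max_in[OF fin this]
  show "\<exists>i j. 1 \<le> i \<and> i < j \<and> j \<le> p \<and> coherence n p x = \<bar>pearson n (x i) (x j)\<bar>"
    unfolding coherence_def by blast
  show "\<bar>pearson n (x i) (x j)\<bar> \<le> coherence n p x" if "1 \<le> i" "i < j" "j \<le> p" for i j
    unfolding coherence_def using that by (intro Max_ge[OF fin]) blast
qed

lemma coherence_bounds:
  assumes "p \<ge> 2" "n \<ge> 1"
  shows "0 \<le> coherence n p x" "coherence n p x \<le> 1"
  using coherence_props(1)[OF assms(1), of n x] abs_pearson_le_1[OF assms(2)] by fastforce+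

text \<open>
  This turns the distribution of the maximum into the probability that some pair is close.
\<close>

lemma coherence_ge_iff:
  assumes "p \<ge> 2"
  shows "a \<le> (coherence n p x)\<^sup>2 \<longleftrightarrow> (\<exists>i\<in>{1..p}. \<exists>j\<in>{1..p}. i < j \<and> a \<le> (pearson n (x i) (x j))\<^sup>2)"
proof
  assume a: "a \<le> (coherence n p x)\<^sup>2"
  obtain i j where ij: "1 \<le> i" "i < j" "j \<le> p" "coherence n p x = \<bar>pearson n (x i) (x j)\<bar>"
    using coherence_props(1)[OF assms] by blast
  then have "a \<le> (pearson n (x i) (x j))\<^sup>2" using a by simp
  then show "\<exists>i\<in>{1..p}. \<exists>j\<in>{1..p}. i < j \<and> a \<le> (pearson n (x i) (x j))\<^sup>2"
    using ij by (intro bexI[of _ i] bexI[of _ j]) auto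
next
  assume "\<exists>i\<in>{1..p}. \<exists>j\<in>{1..p}. i < j \<and> a \<le> (pearson n (x i) (x j))\<^sup>2"
  then obtain i j where ij: "1 \<le> i" "i < j" "j \<le> p" "a \<le> (pearson n (x i) (x j))\<^sup>2" by auto
  have "\<bar>pearson n (x i) (x j)\<bar> \<le> \<bar>coherence n p x\<bar>"
    using coherence_props(2)[OF assms ij(1-3), of n x] by simp
  then have "(pearson n (x i) (x j))\<^sup>2 \<le> (coherence n p x)\<^sup>2" by (simp only: abs_le_square_iff)
  then show "a \<le> (coherence n p x)\<^sup>2" using ij by simp
qed

lemma measurable_pearson [measurable (raw)]:
  assumes "\<And>i. i \<in> {1..n} \<Longrightarrow> (\<lambda>\<omega>. f \<omega> i) \<in> borel_measurable N"
    and "\<And>i. i \<in> {1..n} \<Longrightarrow> (\<lambda>\<omega>. g \<omega> i) \<in> borel_measurable N"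
  shows "(\<lambda>\<omega>. pearson n (f \<omega>) (g \<omega>)) \<in> borel_measurable N"
  unfolding pearson_def mean_def using assms by measurable

lemma measurable_Rn_component:
  assumes "Y \<in> measurable N (Rn n)" "i \<in> {1..n}"
  shows "(\<lambda>\<omega>. Y \<omega> i) \<in> borel_measurable N"
  using measurable_compose[OF assms(1)[unfolded Rn_def] measurable_component_singleton[OF assms(2)]] .

lemma measurable_coherence:
  assumes "\<And>i. i \<in> {1..p} \<Longrightarrow> X i \<in> measurable N (Rn n)"
  shows "(\<lambda>\<omega>. coherence n p (\<lambda>i. X i \<omega>)) \<in> borel_measurable N"
proof -
  let ?I = "{(i, j). 1 \<le> i \<and> i < j \<and> j \<le> p}"
  have "?I \<subseteq> {1..p} \<times> {1..p}" by auto
  then have fin: "finite ?I" by (rule finite_subset) simp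
  have eq: "(\<lambda>\<omega>. coherence n p (\<lambda>i. X i \<omega>)) = (\<lambda>\<omega>. Max ((\<lambda>ij. \<bar>pearson n (X (fst ij) \<omega>) (X (snd ij) \<omega>)\<bar>) ` ?I))"
    unfolding coherence_def by (intro ext arg_cong[where f = Max]) force
  show ?thesis
    unfolding eq
  proof (rule borel_measurable_Max[OF fin])
    fix ij assume "ij \<in> ?I"
    then have "X (fst ij) \<in> measurable N (Rn n)" "X (snd ij) \<in> measurable N (Rn n)"
      by (auto intro!: assms)
    then have "(\<lambda>\<omega>. pearson n (X (fst ij) \<omega>) (X (snd ij) \<omega>)) \<in> borel_measurable N"
      by (intro measurable_pearson measurable_Rn_component)
    then show "(\<lambda>\<omega>. \<bar>pearson n (X (fst ij) \<omega>) (X (snd ij) \<omega>)\<bar>) \<in> borel_measurable N"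
      by measurable
  qed
qed

lemma coherence_distribution:
  fixes X :: "nat \<Rightarrow> 'a \<Rightarrow> nat \<Rightarrow> real"
  assumes n: "n \<ge> 3" and p: "p \<ge> 2" and "prob_space M"
    and ind: "prob_space.indep_vars M (\<lambda>_. Rn n) X {1..p}"
    and sph: "spherical M n (X 1)"
    and law: "\<And>i. i \<in> {1..p} \<Longrightarrow> distr M (Rn n) (X i) = distr M (Rn n) (X 1)"
    and nz: "measure M {\<omega> \<in> space M. \<forall>k\<in>{1..n}. X 1 \<omega> k = 0} = 0"
    and \<delta>: "0 \<le> \<delta>" "\<delta> < 1" and small: "real p * cap_fraction (n - 1) \<delta> \<le> 1"
  defines "q \<equiv> cap_fraction (n - 1) \<delta>"
  shows "\<bar>measure M {\<omega> \<in> space M. (coherence n p (\<lambda>i. X i \<omega>))\<^sup>2 < 1 - \<delta>}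
          - exp (- (q * (real p * (real p - 1) / 2)))\<bar> \<le> real p ^ 3 * q\<^sup>2"
proof -
  interpret prob_space M by fact
  let ?R = "\<lambda>x y. 1 - \<delta> \<le> (pearson n x y)\<^sup>2"
  have "{\<omega> \<in> space M. (coherence n p (\<lambda>i. X i \<omega>))\<^sup>2 < 1 - \<delta>} =
      {\<omega> \<in> space M. \<forall>i\<in>{1..p}. \<forall>j\<in>{1..p}. i < j \<longrightarrow> \<not> ?R (X i \<omega>) (X j \<omega>)}"
    unfolding not_le[symmetric] coherence_ge_iff[OF p] by blast
  moreover have "\<bar>prob {\<omega> \<in> space M. \<forall>i\<in>{1..p}. \<forall>j\<in>{1..p}. i < j \<longrightarrow> \<not> ?R (X i \<omega>) (X j \<omega>)}
          - exp (- (q * (real p * (real p - 1) / 2)))\<bar> \<le> real p ^ 3 * q\<^sup>2"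
  proof (rule prob_no_related_pair[OF ind law])
    have "(\<lambda>z. pearson n (fst z) (snd z)) \<in> borel_measurable (Rn n \<Otimes>\<^sub>M Rn n)"
      by (intro measurable_pearson) (auto intro!: measurable_Rn_component[of _ _ n])
    then show "Measurable.pred (Rn n \<Otimes>\<^sub>M Rn n) (\<lambda>z. ?R (fst z) (snd z))" by measurable
    show "?R x y \<longleftrightarrow> ?R y x" for x y by (simp add: pearson_commute)
    show "AE x in distr M (Rn n) (X 1). measure (distr M (Rn n) (X 1)) {y \<in> space (Rn n). ?R x y} = q"
      unfolding q_def by (rule spherical_pearson_cap[OF n prob_space_axioms sph nz])
    show "real p * q \<le> 1" using small by (simp add: q_def)
    show "0 \<le> q" unfolding q_def cap_fraction_def by simp
  qed auto
  ultimately show ?thesis by simp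
qed

section \<open>Asymptotics of the cap probability\<close>

text \<open>
  Both inequalities are midpoint convexity of \<open>ln \<circ> Gamma\<close>, between \<open>x\<close> and \<open>x + 1\<close> and between
  \<open>x + 1/2\<close> and \<open>x + 3/2\<close>, combined with \<open>Gamma (x + 1) = x * Gamma x\<close>.
\<close>

lemma Gamma_half_shift_bounds:
  fixes x :: real
  assumes "x > 0"
  shows "(Gamma (x + 1/2))\<^sup>2 \<le> x * (Gamma x)\<^sup>2" "x\<^sup>2 * (Gamma x)\<^sup>2 \<le> (x + 1/2) * (Gamma (x + 1/2))\<^sup>2"
proof -
  have mid: "(Gamma (y + 1/2))\<^sup>2 \<le> y * (Gamma y)\<^sup>2" if y: "y > 0" for y :: real
  proof -
    have G: "Gamma y > 0" "Gamma (y + 1) > 0" "Gamma (y + 1/2) > 0"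
      using y by (auto intro!: Gamma_real_pos)
    have "(ln \<circ> Gamma) ((1 - 1/2) *\<^sub>R y + (1/2) *\<^sub>R (y + 1)) \<le>
        (1 - 1/2) * (ln \<circ> Gamma) y + (1/2) * (ln \<circ> Gamma) (y + 1)"
      using y by (intro convex_onD[OF log_convex_Gamma_real]) auto
    also have "(1 - 1/2) *\<^sub>R y + (1/2) *\<^sub>R (y + 1) = y + 1/2" by (simp add: field_simps)
    finally have "2 * ln (Gamma (y + 1/2)) \<le> ln (Gamma y) + ln (Gamma (y + 1))" by simp
    then have "ln ((Gamma (y + 1/2))\<^sup>2) \<le> ln (Gamma y * Gamma (y + 1))"
      using G by (simp add: ln_mult ln_realpow)
    then have "(Gamma (y + 1/2))\<^sup>2 \<le> Gamma y * Gamma (y + 1)"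
      using G by (subst (asm) ln_le_cancel_iff) auto
    also have "Gamma (y + 1) = y * Gamma y" using y by (intro Gamma_plus1) (auto elim!: nonpos_Ints_cases)
    finally show ?thesis by (simp add: power2_eq_square mult_ac)
  qed
  show "(Gamma (x + 1/2))\<^sup>2 \<le> x * (Gamma x)\<^sup>2" by (rule mid[OF assms])
  have "x \<notin> \<int>\<^sub>\<le>\<^sub>0" using assms by (auto elim!: nonpos_Ints_cases)
  then have "Gamma (x + 1/2 + 1/2) = x * Gamma x"
    using Gamma_plus1[of x] by (simp add: add.assoc)
  then show "x\<^sup>2 * (Gamma x)\<^sup>2 \<le> (x + 1/2) * (Gamma (x + 1/2))\<^sup>2"
    using mid[of "x + 1/2"] assms by (simp only: power_mult_distrib)
qed

lemma Gamma_half_shift_asymp: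
  "((\<lambda>x::real. Gamma (x + 1/2) / Gamma x / sqrt x) \<longlongrightarrow> 1) at_top"
proof (rule tendsto_sandwich)
  show "\<forall>\<^sub>F x in at_top. sqrt (x / (x + 1/2)) \<le> Gamma (x + 1/2) / Gamma x / sqrt x"
    using eventually_gt_at_top[of 0]
  proof eventually_elim
    case (elim x)
    have G: "Gamma x > 0" "Gamma (x + 1/2) > 0" using elim by (auto intro!: Gamma_real_pos)
    show ?case
    proof (rule real_le_lsqrt)
      have B: "(Gamma x)\<^sup>2 * x > 0" by (rule mult_pos_pos[OF zero_less_power[OF G(1)] elim])
      have S: "x + 1/2 > 0" using elim by simp
      have "x * ((Gamma x)\<^sup>2 * x) = x\<^sup>2 * (Gamma x)\<^sup>2" by (simp add: power2_eq_square)
      also have "\<dots> \<le> (x + 1/2) * (Gamma (x + 1/2))\<^sup>2" by (rule Gamma_half_shift_bounds(2)[OF elim])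
      finally have "x \<le> (x + 1/2) * (Gamma (x + 1/2))\<^sup>2 / ((Gamma x)\<^sup>2 * x)"
        by (rule pos_le_divide_eq[OF B, THEN iffD2])
      also have "\<dots> = (Gamma (x + 1/2))\<^sup>2 / ((Gamma x)\<^sup>2 * x) * (x + 1/2)"
        by (simp only: times_divide_eq_right mult.commute[of _ "x + 1/2"])
      finally have "x / (x + 1/2) \<le> (Gamma (x + 1/2))\<^sup>2 / ((Gamma x)\<^sup>2 * x)"
        by (rule pos_divide_le_eq[OF S, THEN iffD2])
      also have "(Gamma x)\<^sup>2 * x = (Gamma x * sqrt x)\<^sup>2"
        using elim by (simp only: power_mult_distrib real_sqrt_pow2 less_imp_le)
      also have "(Gamma (x + 1/2))\<^sup>2 / (Gamma x * sqrt x)\<^sup>2 = (Gamma (x + 1/2) / Gamma x / sqrt x)\<^sup>2"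
        by (simp only: power_divide divide_divide_eq_left)
      finally show "x / (x + 1/2) \<le> (Gamma (x + 1/2) / Gamma x / sqrt x)\<^sup>2" .
    next
      show "0 \<le> Gamma (x + 1/2) / Gamma x / sqrt x"
        using G elim by (intro divide_nonneg_nonneg real_sqrt_ge_zero less_imp_le)
    qed
  qed
  show "\<forall>\<^sub>F x in at_top. Gamma (x + 1/2) / Gamma x / sqrt x \<le> 1"
    using eventually_gt_at_top[of 0]
  proof eventually_elim
    case (elim x)
    have G: "Gamma x > 0" "Gamma (x + 1/2) > 0" using elim by (auto intro!: Gamma_real_pos)
    have "Gamma (x + 1/2) \<le> sqrt x * Gamma x"
    proof (rule power2_le_imp_le)
      have "(sqrt x * Gamma x)\<^sup>2 = x * (Gamma x)\<^sup>2"
        using elim by (simp only: power_mult_distrib real_sqrt_pow2 less_imp_le)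
      then show "(Gamma (x + 1/2))\<^sup>2 \<le> (sqrt x * Gamma x)\<^sup>2"
        using Gamma_half_shift_bounds(1)[OF elim] by (simp only:)
      show "0 \<le> sqrt x * Gamma x"
        using G(1) elim by (intro mult_nonneg_nonneg less_imp_le) simp_all
    qed
    then have "Gamma (x + 1/2) / Gamma x \<le> sqrt x" 
      by (rule pos_divide_le_eq[OF G(1), THEN iffD2])
    moreover have "0 < sqrt x" using elim by simp
    ultimately show ?case by (simp only: pos_divide_le_eq mult_1)
  qed
  show "((\<lambda>x::real. sqrt (x / (x + 1/2))) \<longlongrightarrow> 1) at_top" by real_asymp
qed simp

lemma unit_ball_vol_ratio_asymp:
  "(\<lambda>m. unit_ball_vol (real m) / unit_ball_vol (real (m + 1)) / sqrt (real m)) \<longlonglongrightarrow> 1 / sqrt (2 * pi)"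
proof -
  let ?x = "\<lambda>m. real m / 2 + 1"
  have x: "filterlim ?x at_top sequentially" by real_asymp
  have r: "(\<lambda>m. sqrt (?x m) / sqrt (real m)) \<longlonglongrightarrow> 1 / sqrt 2"
  proof -
    have "(\<lambda>m. 1 / 2 + 1 / real m) \<longlonglongrightarrow> 1 / 2" by real_asymp
    then have "(\<lambda>m. sqrt (1 / 2 + 1 / real m)) \<longlonglongrightarrow> sqrt (1 / 2)" by (rule tendsto_real_sqrt)
    moreover have "\<forall>\<^sub>F m in sequentially. sqrt (1 / 2 + 1 / real m) = sqrt (?x m) / sqrt (real m)"
      using eventually_gt_at_top[of 0]
    proof eventually_elim
      case (elim m)
      then have "1 / 2 + 1 / real m = ?x m / real m" by (simp add: add_divide_distrib)
      then show ?case by (simp only: real_sqrt_divide)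
    qed
    ultimately have "(\<lambda>m. sqrt (?x m) / sqrt (real m)) \<longlonglongrightarrow> sqrt (1 / 2)"
      by (rule Lim_transform_eventually)
    then show ?thesis by (simp only: real_sqrt_divide real_sqrt_one)
  qed
  have "(\<lambda>m. Gamma (?x m + 1/2) / Gamma (?x m) / sqrt (?x m) * (sqrt (?x m) / sqrt (real m)) / sqrt pi)
      \<longlonglongrightarrow> 1 * (1 / sqrt 2) / sqrt pi"
    by (rule tendsto_divide[OF tendsto_mult[OF filterlim_compose[OF Gamma_half_shift_asymp x] r] tendsto_const]) simp
  moreover have "\<forall>\<^sub>F m in sequentially.
      Gamma (?x m + 1/2) / Gamma (?x m) / sqrt (?x m) * (sqrt (?x m) / sqrt (real m)) / sqrt pi =
      unit_ball_vol (real m) / unit_ball_vol (real (m + 1)) / sqrt (real m)"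
    using eventually_gt_at_top[of 0]
  proof eventually_elim
    case (elim m)
    have G: "Gamma (?x m) > 0" "Gamma (?x m + 1/2) > 0" by (auto intro!: Gamma_real_pos)
    have "pi powr (real (m + 1) / 2) = pi powr (real m / 2) * sqrt pi"
      by (simp add: powr_half_sqrt[symmetric] powr_add[symmetric] add_divide_distrib add.commute)
    moreover have "real (m + 1) / 2 + 1 = ?x m + 1/2" by (simp add: field_simps)
    ultimately have V: "unit_ball_vol (real (m + 1)) = pi powr (real m / 2) * sqrt pi / Gamma (?x m + 1/2)"
      by (simp only: unit_ball_vol_def)
    have "a / b / s * (s / r) / t = (w / b) / (w * t / a) / r"
      if "a > 0" "b > 0" "s > 0" "w > 0" for a b s r t w :: real
    proof -
      have "a / b / s * (s / r) / t = a / (b * (r * t))" using that by simp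
      moreover have "(w / b) / (w * t / a) / r = a / (b * (r * t))" using that by (simp add: mult_ac)
      ultimately show ?thesis by simp
    qed
    note cancel = this
    have "sqrt (?x m) > 0" "pi powr (real m / 2) > 0" by (simp_all add: add_pos_nonneg)
    note * = cancel[OF G(2,1) this]
    show ?case unfolding V unit_ball_vol_def[of "real m"] by (rule *)
  qed
  ultimately have "(\<lambda>m. unit_ball_vol (real m) / unit_ball_vol (real (m + 1)) / sqrt (real m))
     \<longlonglongrightarrow> 1 * (1 / sqrt 2) / sqrt pi"
    by (rule Lim_transform_eventually)
  then show ?thesis by (simp add: real_sqrt_mult)
qed

text \<open>
  The value of \<open>T\<close> at which the normalised statistic equals \<open>y\<close>.
\<close>

definition threshold :: "(nat \<Rightarrow> nat) \<Rightarrow> real \<Rightarrow> nat \<Rightarrow> real" where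
  "threshold p y n = (y + ln (real n)) / real n - 4 / (real n - 2) * ln (real (p n))"

lemma growth_consequences:
  fixes p :: "nat \<Rightarrow> nat"
  assumes growth: "filterlim (\<lambda>n. ln (real (p n)) / real n) at_top sequentially"
  shows "filterlim (\<lambda>n. ln (real (p n))) at_top sequentially"
    and "filterlim (\<lambda>n. real (p n)) at_top sequentially"
    and "eventually (\<lambda>n. p n \<ge> 2) sequentially"
    and "(\<lambda>n. real n / ln (real (p n))) \<longlonglongrightarrow> 0"
    and "(\<lambda>n. ln (real n) / ln (real (p n))) \<longlonglongrightarrow> 0"
proof -
  show l: "filterlim (\<lambda>n. ln (real (p n))) at_top sequentially"
  proof (rule filterlim_at_top_mono[OF growth])
    show "\<forall>\<^sub>F n in sequentially. ln (real (p n)) / real n \<le> ln (real (p n))"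
      using eventually_ge_at_top[of 1]
    proof eventually_elim
      case (elim n)
      have "0 \<le> ln (real (p n))" by (cases "p n = 0") auto
      then have "ln (real (p n)) * 1 \<le> ln (real (p n)) * real n"
        using elim by (intro mult_left_mono) auto
      then show ?case using elim by (simp add: field_simps)
    qed
  qed
  show P: "filterlim (\<lambda>n. real (p n)) at_top sequentially"
  proof (rule filterlim_at_top_mono[OF l])
    show "\<forall>\<^sub>F n in sequentially. ln (real (p n)) \<le> real (p n)"
    proof (rule always_eventually, rule allI)
      fix n
      show "ln (real (p n)) \<le> real (p n)"
        using ln_le_minus_one[of "real (p n)"] by (cases "p n = 0") auto
    qed
  qed
  show "eventually (\<lambda>n. p n \<ge> 2) sequentially"
    using filterlim_at_top[THEN iffD1, OF P, rule_format, of 2] by eventually_elim simp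
  have "(\<lambda>n. inverse (ln (real (p n)) / real n)) \<longlonglongrightarrow> 0"
    by (rule filterlim_compose[OF tendsto_inverse_0_at_top[OF filterlim_ident] growth])
  then show r: "(\<lambda>n. real n / ln (real (p n))) \<longlonglongrightarrow> 0" by simp
  have "(\<lambda>n. ln (real n) / real n * (real n / ln (real (p n)))) \<longlonglongrightarrow> 0 * 0"
    by (intro tendsto_mult r) real_asymp
  moreover have "\<forall>\<^sub>F n in sequentially. ln (real n) / real n * (real n / ln (real (p n))) = ln (real n) / ln (real (p n))"
    using eventually_gt_at_top[of 0] by eventually_elim simp
  ultimately have "(\<lambda>n. ln (real n) / ln (real (p n))) \<longlonglongrightarrow> 0 * 0"
    by (rule Lim_transform_eventually)
  then show "(\<lambda>n. ln (real n) / ln (real (p n))) \<longlonglongrightarrow> 0" by simp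
qed

lemma exp_threshold_tendsto_0:
  fixes p :: "nat \<Rightarrow> nat"
  assumes growth: "filterlim (\<lambda>n. ln (real (p n)) / real n) at_top sequentially"
  shows "(\<lambda>n. exp (threshold p y n)) \<longlonglongrightarrow> 0"
proof -
  have a: "(\<lambda>n. (y + ln (real n)) / real n) \<longlonglongrightarrow> 0" by real_asymp
  have "filterlim (\<lambda>n. ln (real (p n)) / real n + (- ((y + ln (real n)) / real n))) at_top sequentially"
    using tendsto_minus[OF a] growth filterlim_tendsto_add_at_top[of "\<lambda>n. - ((y + ln (real n)) / real n)" "- 0"]
    by (simp add: add.commute)
  then have "filterlim (\<lambda>n. - threshold p y n) at_top sequentially"
  proof (rule filterlim_at_top_mono)
    show "\<forall>\<^sub>F n in sequentially. ln (real (p n)) / real n + (- ((y + ln (real n)) / real n)) \<le> - threshold p y n"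
      using eventually_ge_at_top[of 3]
    proof eventually_elim
      case (elim n)
      have "0 \<le> ln (real (p n))" by (cases "p n = 0") auto
      moreover have "1 / real n \<le> 4 / (real n - 2)" using elim by (simp add: field_simps)
      ultimately have "1 / real n * ln (real (p n)) \<le> 4 / (real n - 2) * ln (real (p n))"
        by (rule mult_right_mono[rotated])
      then show ?case by (simp add: threshold_def)
    qed
  qed
  then have "filterlim (\<lambda>n. threshold p y n) at_bot sequentially"
    by (subst (asm) filterlim_uminus_at_bot[symmetric])
  then show ?thesis by (rule filterlim_compose[OF exp_at_bot])
qed

text \<open>
  With \<open>\<delta> = exp (threshold p y n)\<close> the leading factor \<open>sqrt \<delta> ^ (n - 2)\<close> of the cap volume is
  \<open>p\<^sup>-\<^sup>2 exp ((n - 2) / (2 n) * (y + ln n))\<close>: the coefficient \<open>4 / (n - 2)\<close> produces exactly the power of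
  \<open>p\<close>, and \<open>ln n\<close> produces a factor \<open>sqrt n\<close> that cancels the ratio of ball volumes, of order
  \<open>sqrt n\<close>, times the \<open>1 / n\<close> from integration.
\<close>

lemma cap_fraction_threshold_asymp:
  fixes p :: "nat \<Rightarrow> nat"
  assumes growth: "filterlim (\<lambda>n. ln (real (p n)) / real n) at_top sequentially"
  shows "(\<lambda>n. real (p n) ^ 2 * cap_fraction (n - 1) (exp (threshold p y n))) \<longlonglongrightarrow> 2 * (1 / sqrt (2 * pi) * exp (y / 2))"
proof -
  define \<delta> where "\<delta> n = exp (threshold p y n)" for n
  have d0: "\<delta> \<longlonglongrightarrow> 0" unfolding \<delta>_def by (rule exp_threshold_tendsto_0[OF growth])
  define c where "c n = real (p n) ^ 2 * (unit_ball_vol (real (n - 2)) / unit_ball_vol (real (n - 1)) *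
      (2 * sqrt (\<delta> n) ^ (n - 2) / real (n - 1)))" for n
  have "(\<lambda>n. unit_ball_vol (real (n - 2)) / unit_ball_vol (real ((n - 2) + 1)) / sqrt (real (n - 2))) \<longlonglongrightarrow> 1 / sqrt (2 * pi)"
    by (rule filterlim_compose[OF unit_ball_vol_ratio_asymp]) (rule filterlim_minus_const_nat_at_top)
  moreover have "(\<lambda>n. sqrt (real n - 2) * 2 / (real n - 1) * exp ((real n - 2) / (2 * real n) * (y + ln (real n))))
      \<longlonglongrightarrow> 2 * exp (y / 2)"
    by real_asymp
  ultimately have "(\<lambda>n. unit_ball_vol (real (n - 2)) / unit_ball_vol (real ((n - 2) + 1)) / sqrt (real (n - 2)) *
      (sqrt (real n - 2) * 2 / (real n - 1) * exp ((real n - 2) / (2 * real n) * (y + ln (real n)))))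
      \<longlonglongrightarrow> 1 / sqrt (2 * pi) * (2 * exp (y / 2))"
    by (rule tendsto_mult)
  moreover have "\<forall>\<^sub>F n in sequentially. unit_ball_vol (real (n - 2)) / unit_ball_vol (real ((n - 2) + 1)) / sqrt (real (n - 2)) *
      (sqrt (real n - 2) * 2 / (real n - 1) * exp ((real n - 2) / (2 * real n) * (y + ln (real n)))) = c n"
    using eventually_ge_at_top[of 3] growth_consequences(3)[OF growth]
  proof eventually_elim
    case (elim n)
    have n: "n - 2 + 1 = n - 1" "real (n - 2) = real n - 2" "real (n - 1) = real n - 1" "real n - 2 > 0"
      using elim by auto
    have "sqrt (\<delta> n) = exp (threshold p y n / 2)"
      unfolding \<delta>_def by (rule real_sqrt_unique) (simp_all flip: exp_double)
    then have "sqrt (\<delta> n) ^ (n - 2) = exp ((real n - 2) * (threshold p y n / 2))"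
      using n by (simp flip: exp_of_nat_mult)
    also have "(real n - 2) * (threshold p y n / 2) = (real n - 2) / (2 * real n) * (y + ln (real n)) - 2 * ln (real (p n))"
      using n unfolding threshold_def by (simp add: field_simps)
    also have "exp \<dots> = exp ((real n - 2) / (2 * real n) * (y + ln (real n))) / exp (2 * ln (real (p n)))"
      by (rule exp_diff)
    also have "exp (2 * ln (real (p n))) = real (p n) ^ 2"
      using elim by (simp add: exp_double)
    finally have s: "real (p n) ^ 2 * sqrt (\<delta> n) ^ (n - 2) = exp ((real n - 2) / (2 * real n) * (y + ln (real n)))"
      using elim by simp
    have "c n = unit_ball_vol (real (n - 2)) / unit_ball_vol (real (n - 1)) *
      (2 * (real (p n) ^ 2 * sqrt (\<delta> n) ^ (n - 2)) / real (n - 1))"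
      by (simp add: c_def)
    then show ?case unfolding s unfolding n using n(4) by simp
  qed
  ultimately have "c \<longlonglongrightarrow> 1 / sqrt (2 * pi) * (2 * exp (y / 2))"
    by (rule Lim_transform_eventually)
  then have c: "c \<longlonglongrightarrow> 2 * (1 / sqrt (2 * pi) * exp (y / 2))" by (simp add: mult_ac)
  have lo: "(\<lambda>n. c n * sqrt (1 - \<delta> n)) \<longlonglongrightarrow> 2 * (1 / sqrt (2 * pi) * exp (y / 2)) * sqrt (1 - 0)"
    by (intro tendsto_intros c d0)
  have hi: "(\<lambda>n. c n * (sqrt (1 - \<delta> n) + \<delta> n / sqrt (1 - \<delta> n))) \<longlonglongrightarrow>
      2 * (1 / sqrt (2 * pi) * exp (y / 2)) * (sqrt (1 - 0) + 0 / sqrt (1 - 0))"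
    by (intro tendsto_intros c d0) simp
  have ev: "\<forall>\<^sub>F n in sequentially. \<delta> n < 1" using order_tendstoD(2)[OF d0, of 1] by simp
  have bounds: "c n * sqrt (1 - \<delta> n) \<le> real (p n) ^ 2 * cap_fraction (n - 1) (\<delta> n)"
    "real (p n) ^ 2 * cap_fraction (n - 1) (\<delta> n) \<le> c n * (sqrt (1 - \<delta> n) + \<delta> n / sqrt (1 - \<delta> n))"
    if "\<delta> n < 1" "n \<ge> 3" for n
  proof -
    have e: "n - 1 - 1 = n - 2" using that by simp
    have "n - 1 \<ge> 2" "0 \<le> \<delta> n" using that by (auto simp: \<delta>_def)
    note b = cap_fraction_bounds[OF this that(1), unfolded e]
    show "c n * sqrt (1 - \<delta> n) \<le> real (p n) ^ 2 * cap_fraction (n - 1) (\<delta> n)"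
      using mult_left_mono[OF b(1), of "real (p n) ^ 2"] by (simp only: c_def mult.assoc) simp
    show "real (p n) ^ 2 * cap_fraction (n - 1) (\<delta> n) \<le> c n * (sqrt (1 - \<delta> n) + \<delta> n / sqrt (1 - \<delta> n))"
      using mult_left_mono[OF b(2), of "real (p n) ^ 2"] by (simp only: c_def mult.assoc) simp
  qed
  show ?thesis
    unfolding \<delta>_def[symmetric]
  proof (rule tendsto_sandwich)
    show "\<forall>\<^sub>F n in sequentially. c n * sqrt (1 - \<delta> n) \<le> real (p n) ^ 2 * cap_fraction (n - 1) (\<delta> n)"
      using ev eventually_ge_at_top[of 3] by eventually_elim (rule bounds)
    show "\<forall>\<^sub>F n in sequentially. real (p n) ^ 2 * cap_fraction (n - 1) (\<delta> n) \<le> c n * (sqrt (1 - \<delta> n) + \<delta> n / sqrt (1 - \<delta> n))"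
      using ev eventually_ge_at_top[of 3] by eventually_elim (rule bounds)
  qed (use lo hi in simp_all)
qed

section \<open>The limit laws\<close>

text \<open>
  The limit law is built from its distribution function; the two limits at infinity are also what
  tightness needs.
\<close>

lemma extreme_value_distribution:
  fixes K :: real
  assumes "K > 0"
  defines "F \<equiv> \<lambda>y. 1 - exp (- K * exp (y / 2))"
  shows "real_distribution (interval_measure F)" "cdf (interval_measure F) = F"
    and "(F \<longlongrightarrow> 0) at_bot" "(F \<longlongrightarrow> 1) at_top"
proof -
  have mono: "F x \<le> F y" if "x \<le> y" for x y
    using that assms by (simp add: F_def)
  have cont: "continuous (at_right a) F" for a
    unfolding F_def by (intro continuous_intros) simp
  show bot: "(F \<longlongrightarrow> 0) at_bot" unfolding F_def using assms(1) by real_asymp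
  show top: "(F \<longlongrightarrow> 1) at_top" unfolding F_def using assms(1) by real_asymp
  show "real_distribution (interval_measure F)"
    by (rule real_distribution_interval_measure[OF mono cont bot top])
  show "cdf (interval_measure F) = F"
    by (rule cdf_interval_measure[OF mono cont bot])
qed

lemma tight_of_distribution_limit:
  fixes W :: "nat \<Rightarrow> 'a \<Rightarrow> real" and F :: "real \<Rightarrow> real"
  assumes P: "\<forall>\<^sub>F n in sequentially. prob_space (M n)"
    and W: "\<forall>\<^sub>F n in sequentially. W n \<in> borel_measurable (M n)"
    and lim: "\<And>y. (\<lambda>n. measure (M n) {\<omega> \<in> space (M n). W n \<omega> \<le> y}) \<longlonglongrightarrow> F y"
    and bot: "(F \<longlongrightarrow> 0) at_bot" and top: "(F \<longlongrightarrow> 1) at_top"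
    and b: "filterlim b at_top sequentially"
  shows "(\<lambda>n. measure (M n) {\<omega> \<in> space (M n). \<bar>W n \<omega>\<bar> > b n}) \<longlonglongrightarrow> 0"
proof (rule order_tendstoI)
  fix a :: real assume "a < 0"
  then show "\<forall>\<^sub>F n in sequentially. a < measure (M n) {\<omega> \<in> space (M n). \<bar>W n \<omega>\<bar> > b n}"
    by (intro always_eventually allI) (rule less_le_trans[OF _ measure_nonneg])
next
  fix e :: real assume e: "0 < e"
  have "\<forall>\<^sub>F y in at_bot. F y < e / 2" using order_tendstoD(2)[OF bot, of "e / 2"] e by simp
  then obtain y1 where y1: "F y1 < e / 2" by (meson eventually_at_bot_linorder order_refl)
  have "\<forall>\<^sub>F y in at_top. 1 - e / 2 < F y" using order_tendstoD(1)[OF top, of "1 - e / 2"] e by simp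
  then obtain y2 where y2: "1 - e / 2 < F y2" by (meson eventually_at_top_linorder order_refl)
  have "\<forall>\<^sub>F n in sequentially. b n \<ge> max y2 (- y1)" using b by (simp only: filterlim_at_top)
  with P W order_tendstoD(2)[OF lim y1] order_tendstoD(1)[OF lim y2]
  show "\<forall>\<^sub>F n in sequentially. measure (M n) {\<omega> \<in> space (M n). \<bar>W n \<omega>\<bar> > b n} < e"
  proof eventually_elim
    case (elim n)
    interpret prob_space "M n" by fact
    have [measurable]: "W n \<in> borel_measurable (M n)" by fact
    have "prob {\<omega> \<in> space (M n). \<bar>W n \<omega>\<bar> > b n} \<le>
        prob ({\<omega> \<in> space (M n). W n \<omega> \<le> y1} \<union> (space (M n) - {\<omega> \<in> space (M n). W n \<omega> \<le> y2}))"
      using elim by (intro finite_measure_mono) auto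
    also have "\<dots> \<le> prob {\<omega> \<in> space (M n). W n \<omega> \<le> y1} + prob (space (M n) - {\<omega> \<in> space (M n). W n \<omega> \<le> y2})"
      by (rule measure_Un_le) measurable
    also have "prob (space (M n) - {\<omega> \<in> space (M n). W n \<omega> \<le> y2}) = 1 - prob {\<omega> \<in> space (M n). W n \<omega> \<le> y2}"
      by (rule prob_compl) measurable
    finally show ?case using elim by linarith
  qed
qed

theorem theorem3:
  fixes p :: "nat \<Rightarrow> nat"
    and M :: "nat \<Rightarrow> 'a measure"
    and X :: "nat \<Rightarrow> nat \<Rightarrow> 'a \<Rightarrow> nat \<Rightarrow> real"
    and L T :: "nat \<Rightarrow> 'a \<Rightarrow> real"
    and K :: real
  assumes "filterlim (\<lambda>n. ln (real (p n)) / real n) at_top sequentially"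
    and "\<And>n. n \<ge> 1 \<Longrightarrow> prob_space (M n)"
    and "\<And>n. n \<ge> 1 \<Longrightarrow> prob_space.indep_vars (M n) (\<lambda>_. Rn n) (X n) {1..p n}"
    and "\<And>n i. n \<ge> 1 \<Longrightarrow> i \<in> {1..p n} \<Longrightarrow> spherical (M n) n (X n i)"
    and "\<And>n i. n \<ge> 1 \<Longrightarrow> i \<in> {1..p n} \<Longrightarrow>
           distr (M n) (Rn n) (X n i) = distr (M n) (Rn n) (X n 1)"
    and "\<And>n. n \<ge> 1 \<Longrightarrow> p n \<ge> 1 \<Longrightarrow>
           measure (M n) {\<omega> \<in> space (M n). \<forall>k\<in>{1..n}. X n 1 \<omega> k = 0} = 0"
  defines "L \<equiv> (\<lambda>n \<omega>. coherence n (p n) (\<lambda>i. X n i \<omega>))"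
    and "T \<equiv> (\<lambda>n \<omega>. ln (1 - (L n \<omega>)^2))"
    and "K \<equiv> 1 / sqrt (2 * pi)"
  shows "conv_in_prob M L 1 \<and>
         conv_in_prob M (\<lambda>n \<omega>. real n / ln (real (p n)) * T n \<omega>) (-4) \<and>
         (\<exists>N. real_distribution N \<and>
           (\<forall>y. cdf N y = 1 - exp (- K * exp (y / 2))) \<and>
           conv_in_law M
             (\<lambda>n \<omega>. real n * T n \<omega> + 4 * real n / (real n - 2) * ln (real (p n)) - ln (real n)) N)"
proof -
  note growth = assms(1)
  define W where "W n \<omega> = real n * T n \<omega> + 4 * real n / (real n - 2) * ln (real (p n)) - ln (real n)" for n \<omega>
  define F where "F y = 1 - exp (- K * exp (y / 2))" for y
  define \<delta> where "\<delta> y n = exp (threshold p y n)" for y n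
  have K: "K > 0" by (simp add: K_def)
  note F = extreme_value_distribution[OF K, folded F_def]
  note logp = growth_consequences(1)[OF growth]
  have large: "\<forall>\<^sub>F n in sequentially. n \<ge> 3 \<and> p n \<ge> 2"
    using eventually_ge_at_top[of 3] growth_consequences(3)[OF growth] by eventually_elim simp
  have X: "X n i \<in> measurable (M n) (Rn n)" if "n \<ge> 1" "i \<in> {1..p n}" for n i
    using assms(4)[OF that] by (simp add: spherical_def)
  have L: "L n \<in> borel_measurable (M n)" if "n \<ge> 1" for n
    unfolding L_def using X[OF that] by (rule measurable_coherence)
  have T: "T n \<in> borel_measurable (M n)" if "n \<ge> 1" for n
    unfolding T_def using L[OF that] by measurable
  have W: "W n \<in> borel_measurable (M n)" if "n \<ge> 1" for n
    unfolding W_def using T[OF that] by measurable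
  have L01: "0 \<le> L n \<omega>" "L n \<omega> \<le> 1" if "n \<ge> 3 \<and> p n \<ge> 2" for n \<omega>
    unfolding L_def using coherence_bounds[of "p n" n] that by auto

  have dist: "\<bar>measure (M n) {\<omega> \<in> space (M n). (L n \<omega>)\<^sup>2 < 1 - d}
        - exp (- (cap_fraction (n - 1) d * (real (p n) * (real (p n) - 1) / 2)))\<bar>
      \<le> real (p n) ^ 3 * (cap_fraction (n - 1) d)\<^sup>2"
    if n: "n \<ge> 3 \<and> p n \<ge> 2" and d: "0 \<le> d" "d < 1" "real (p n) * cap_fraction (n - 1) d \<le> 1" for n d
    unfolding L_def
  proof (rule coherence_distribution)
    have n1: "n \<ge> 1" using n by simp
    show "prob_space (M n)" by (rule assms(2)[OF n1])
    show "prob_space.indep_vars (M n) (\<lambda>_. Rn n) (X n) {1..p n}" by (rule assms(3)[OF n1])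
    show "spherical (M n) n (X n 1)" using n by (intro assms(4)[OF n1]) simp
    show "distr (M n) (Rn n) (X n i) = distr (M n) (Rn n) (X n 1)" if "i \<in> {1..p n}" for i
      by (rule assms(5)[OF n1 that])
    show "measure (M n) {\<omega> \<in> space (M n). \<forall>k\<in>{1..n}. X n 1 \<omega> k = 0} = 0"
      using n by (intro assms(6)[OF n1]) simp
  qed (use n d in simp_all)

  \<comment> \<open>At \<open>L = 1\<close> the convention \<open>ln 0 = 0\<close> would give \<open>T\<close> the wrong value; the case \<open>\<delta> = 0\<close> excludes it.\<close>
  have proper: "AE \<omega> in M n. (L n \<omega>)\<^sup>2 < 1" if n: "n \<ge> 3 \<and> p n \<ge> 2" for n
  proof -
    interpret prob_space "M n" using assms(2) n by simp
    have "prob {\<omega> \<in> space (M n). (L n \<omega>)\<^sup>2 < 1} = 1"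
    proof -
      have "cap_fraction (n - 1) 0 = 0" using n by (intro cap_fraction_0) linarith
      then show ?thesis using dist[OF n, of 0] by (intro antisym prob_le_1) simp
    qed
    moreover have "{\<omega> \<in> space (M n). (L n \<omega>)\<^sup>2 < 1} \<in> sets (M n)"
    proof -
      have [measurable]: "L n \<in> borel_measurable (M n)" using n by (intro L) simp
      show ?thesis by measurable
    qed
    ultimately have "AE \<omega> in M n. \<omega> \<in> {\<omega> \<in> space (M n). (L n \<omega>)\<^sup>2 < 1}"
      by (simp only: prob_eq_1)
    then show ?thesis by eventually_elim simp
  qed

  have W_cdf: "measure (M n) {\<omega> \<in> space (M n). W n \<omega> \<le> y} =
      1 - measure (M n) {\<omega> \<in> space (M n). (L n \<omega>)\<^sup>2 < 1 - \<delta> y n}" if n: "n \<ge> 3 \<and> p n \<ge> 2" for n y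
  proof -
    interpret prob_space "M n" using assms(2) n by simp
    have [measurable]: "L n \<in> borel_measurable (M n)" "W n \<in> borel_measurable (M n)"
      using L W n by auto
    have "measure (M n) {\<omega> \<in> space (M n). W n \<omega> \<le> y} =
        prob (space (M n) - {\<omega> \<in> space (M n). (L n \<omega>)\<^sup>2 < 1 - \<delta> y n})"
    proof (rule measure_eq_AE)
      show "AE \<omega> in M n. \<omega> \<in> {\<omega> \<in> space (M n). W n \<omega> \<le> y} \<longleftrightarrow>
          \<omega> \<in> space (M n) - {\<omega> \<in> space (M n). (L n \<omega>)\<^sup>2 < 1 - \<delta> y n}"
        using proper[OF n]
      proof eventually_elim
        case (elim \<omega>)
        have "W n \<omega> \<le> y \<longleftrightarrow> real n * T n \<omega> \<le> real n * threshold p y n"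
        proof -
          have "real n * threshold p y n = y + ln (real n) - 4 * real n / (real n - 2) * ln (real (p n))"
            using n by (simp add: threshold_def right_diff_distrib)
          then show ?thesis by (auto simp: W_def)
        qed
        also have "\<dots> \<longleftrightarrow> ln (1 - (L n \<omega>)\<^sup>2) \<le> threshold p y n"
          using n by (simp add: T_def)
        also have "\<dots> \<longleftrightarrow> 1 - (L n \<omega>)\<^sup>2 \<le> \<delta> y n"
          unfolding \<delta>_def using elim ln_le_cancel_iff[of "1 - (L n \<omega>)\<^sup>2" "exp (threshold p y n)"] by simp
        finally show ?case by auto
      qed
    qed measurable
    then show ?thesis by (simp add: prob_compl)
  qed

  have W_lim: "(\<lambda>n. measure (M n) {\<omega> \<in> space (M n). W n \<omega> \<le> y}) \<longlonglongrightarrow> F y" for y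
  proof -
    have d1: "\<forall>\<^sub>F n in sequentially. \<delta> y n < 1"
      unfolding \<delta>_def using order_tendstoD(2)[OF exp_threshold_tendsto_0[OF growth], of 1] by simp
    have "(\<lambda>n. measure (M n) {\<omega> \<in> space (M n). (L n \<omega>)\<^sup>2 < 1 - \<delta> y n}) \<longlonglongrightarrow> exp (- (K * exp (y / 2)))"
    proof (rule avoidance_limit[OF growth_consequences(2)[OF growth]])
      show "(\<lambda>n. real (p n) ^ 2 * cap_fraction (n - 1) (\<delta> y n)) \<longlonglongrightarrow> 2 * (K * exp (y / 2))"
        unfolding \<delta>_def K_def by (rule cap_fraction_threshold_asymp[OF growth])
      show "\<forall>\<^sub>F n in sequentially. real (p n) * cap_fraction (n - 1) (\<delta> y n) \<le> 1 \<longrightarrow>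
         \<bar>measure (M n) {\<omega> \<in> space (M n). (L n \<omega>)\<^sup>2 < 1 - \<delta> y n} -
          exp (- (cap_fraction (n - 1) (\<delta> y n) * (real (p n) * (real (p n) - 1) / 2)))\<bar>
         \<le> real (p n) ^ 3 * (cap_fraction (n - 1) (\<delta> y n))\<^sup>2"
        using large d1
      proof (eventually_elim, intro impI)
        fix n assume "3 \<le> n \<and> 2 \<le> p n" "\<delta> y n < 1" "real (p n) * cap_fraction (n - 1) (\<delta> y n) \<le> 1"
        then show "\<bar>measure (M n) {\<omega> \<in> space (M n). (L n \<omega>)\<^sup>2 < 1 - \<delta> y n} -
          exp (- (cap_fraction (n - 1) (\<delta> y n) * (real (p n) * (real (p n) - 1) / 2)))\<bar>
         \<le> real (p n) ^ 3 * (cap_fraction (n - 1) (\<delta> y n))\<^sup>2"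
          by (intro dist) (simp_all add: \<delta>_def)
      qed
    qed
    then have "(\<lambda>n. 1 - measure (M n) {\<omega> \<in> space (M n). (L n \<omega>)\<^sup>2 < 1 - \<delta> y n}) \<longlonglongrightarrow> 1 - exp (- (K * exp (y / 2)))"
      by (intro tendsto_intros)
    moreover have "\<forall>\<^sub>F n in sequentially. 1 - measure (M n) {\<omega> \<in> space (M n). (L n \<omega>)\<^sup>2 < 1 - \<delta> y n} =
        measure (M n) {\<omega> \<in> space (M n). W n \<omega> \<le> y}"
      using large by eventually_elim (rule W_cdf[symmetric])
    ultimately have "(\<lambda>n. measure (M n) {\<omega> \<in> space (M n). W n \<omega> \<le> y}) \<longlonglongrightarrow> 1 - exp (- (K * exp (y / 2)))"
      by (rule Lim_transform_eventually)
    then show ?thesis by (simp add: F_def)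
  qed

  have law: "conv_in_law M W (interval_measure F)"
    unfolding conv_in_law_def weak_conv_m_def weak_conv_def F(2)
  proof (intro conjI allI impI)
    show "\<forall>\<^sub>F n in sequentially. W n \<in> borel_measurable (M n)"
      using large by eventually_elim (rule W, simp)
    fix y
    have "\<forall>\<^sub>F n in sequentially. measure (M n) {\<omega> \<in> space (M n). W n \<omega> \<le> y} = cdf (distr (M n) borel (W n)) y"
      using large
    proof eventually_elim
      case (elim n)
      then have "W n \<in> borel_measurable (M n)" using W by simp
      then show ?case
        by (simp add: cdf_def measure_distr vimage_def Int_def conj_commute)
    qed
    then show "(\<lambda>n. cdf (distr (M n) borel (W n)) y) \<longlonglongrightarrow> F y"
      by (rule Lim_transform_eventually[OF W_lim])
  qed

  have T_prob: "conv_in_prob M (\<lambda>n \<omega>. real n / ln (real (p n)) * T n \<omega>) (-4)"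
    unfolding conv_in_prob_def
  proof (intro conjI allI impI)
    show "\<forall>\<^sub>F n in sequentially. (\<lambda>\<omega>. real n / ln (real (p n)) * T n \<omega>) \<in> borel_measurable (M n)"
      using large
    proof eventually_elim
      case (elim n)
      then have [measurable]: "T n \<in> borel_measurable (M n)" using T by simp
      show ?case by measurable
    qed
    fix \<epsilon> :: real assume \<epsilon>: "\<epsilon> > 0"
    \<comment> \<open>\<open>n T / ln p + 4\<close> is \<open>W / ln p\<close> plus a null sequence, and \<open>W\<close> is tight while \<open>ln p\<close> tends to infinity.\<close>
    have b: "filterlim (\<lambda>n. \<epsilon> / 2 * ln (real (p n))) at_top sequentially"
      using \<epsilon> by (intro filterlim_tendsto_pos_mult_at_top[OF tendsto_const _ logp]) simp
    have tail: "(\<lambda>n. measure (M n) {\<omega> \<in> space (M n). \<bar>W n \<omega>\<bar> > \<epsilon> / 2 * ln (real (p n))}) \<longlonglongrightarrow> 0"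
    proof (rule tight_of_distribution_limit[OF _ _ W_lim F(3,4) b])
      show "\<forall>\<^sub>F n in sequentially. prob_space (M n)" using large by eventually_elim (simp add: assms(2))
      show "\<forall>\<^sub>F n in sequentially. W n \<in> borel_measurable (M n)" using large by eventually_elim (simp add: W)
    qed
    have "(\<lambda>n. ln (real n) / ln (real (p n)) - 8 / (real n - 2)) \<longlonglongrightarrow> 0 - 0"
      by (intro tendsto_diff growth_consequences(5)[OF growth]) real_asymp
    from tendstoD[OF this, of "\<epsilon> / 2"] \<epsilon>
    have r: "\<forall>\<^sub>F n in sequentially. \<bar>ln (real n) / ln (real (p n)) - 8 / (real n - 2)\<bar> < \<epsilon> / 2"
      by (simp add: dist_real_def)
    show "(\<lambda>n. measure (M n) {\<omega> \<in> space (M n). \<bar>real n / ln (real (p n)) * T n \<omega> - - 4\<bar> > \<epsilon>}) \<longlonglongrightarrow> 0"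
    proof (rule tendsto_sandwich[OF _ _ tendsto_const tail])
      show "\<forall>\<^sub>F n in sequentially. measure (M n) {\<omega> \<in> space (M n). \<bar>real n / ln (real (p n)) * T n \<omega> - - 4\<bar> > \<epsilon>}
          \<le> measure (M n) {\<omega> \<in> space (M n). \<bar>W n \<omega>\<bar> > \<epsilon> / 2 * ln (real (p n))}"
        using large r
      proof eventually_elim
        case (elim n)
        interpret prob_space "M n" using assms(2) elim by simp
        have [measurable]: "W n \<in> borel_measurable (M n)" using W elim by simp
        have l: "ln (real (p n)) > 0" using elim by simp
        show ?case
        proof (rule finite_measure_mono)
          show "{\<omega> \<in> space (M n). \<bar>real n / ln (real (p n)) * T n \<omega> - - 4\<bar> > \<epsilon>} \<subseteq>
              {\<omega> \<in> space (M n). \<bar>W n \<omega>\<bar> > \<epsilon> / 2 * ln (real (p n))}"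
          proof clarify
            fix \<omega> assume a: "\<epsilon> < \<bar>real n / ln (real (p n)) * T n \<omega> - - 4\<bar>"
            have "4 * real n / (real n - 2) = 4 + 8 / (real n - 2)"
              using elim by (simp add: field_simps)
            then have "W n \<omega> = real n * T n \<omega> + (4 + 8 / (real n - 2)) * ln (real (p n)) - ln (real n)"
              by (simp only: W_def)
            then have "W n \<omega> / ln (real (p n)) =
                real n / ln (real (p n)) * T n \<omega> + 4 + 8 / (real n - 2) - ln (real n) / ln (real (p n))"
              using l by (simp add: add_divide_distrib diff_divide_distrib)
            then have "\<epsilon> / 2 < \<bar>W n \<omega> / ln (real (p n))\<bar>" using a elim by linarith
            then have "\<epsilon> / 2 < \<bar>W n \<omega>\<bar> / ln (real (p n))" using l by (simp add: abs_divide)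
            then show "\<epsilon> / 2 * ln (real (p n)) < \<bar>W n \<omega>\<bar>" by (simp only: pos_less_divide_eq[OF l])
          qed
        qed measurable
      qed
    qed simp
  qed

  have L_prob: "conv_in_prob M L 1"
    unfolding conv_in_prob_def
  proof (intro conjI allI impI)
    show "\<forall>\<^sub>F n in sequentially. L n \<in> borel_measurable (M n)"
      using large by eventually_elim (simp add: L)
    fix \<epsilon> :: real assume \<epsilon>: "\<epsilon> > 0"
    \<comment> \<open>If \<open>L\<close> stays below \<open>1 - \<eta>\<close> then \<open>T \<ge> ln \<eta>\<close>, so \<open>n T / ln p\<close> is close to 0, far from its limit \<open>-4\<close>.\<close>
    define \<eta> where "\<eta> = min \<epsilon> (1/2)"
    have \<eta>: "0 < \<eta>" "\<eta> < 1" "\<eta> \<le> \<epsilon>" using \<epsilon> by (auto simp: \<eta>_def)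
    have tail: "(\<lambda>n. measure (M n) {\<omega> \<in> space (M n). \<bar>real n / ln (real (p n)) * T n \<omega> - - 4\<bar> > 1}) \<longlonglongrightarrow> 0"
      using T_prob unfolding conv_in_prob_def by simp
    have "(\<lambda>n. real n / ln (real (p n)) * ln \<eta>) \<longlonglongrightarrow> 0 * ln \<eta>"
      by (intro tendsto_intros growth_consequences(4)[OF growth])
    then have s: "\<forall>\<^sub>F n in sequentially. -3 < real n / ln (real (p n)) * ln \<eta>"
      by (intro order_tendstoD(1)) auto
    show "(\<lambda>n. measure (M n) {\<omega> \<in> space (M n). \<bar>L n \<omega> - 1\<bar> > \<epsilon>}) \<longlonglongrightarrow> 0"
    proof (rule tendsto_sandwich[OF _ _ tendsto_const tail])
      show "\<forall>\<^sub>F n in sequentially. measure (M n) {\<omega> \<in> space (M n). \<bar>L n \<omega> - 1\<bar> > \<epsilon>}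
          \<le> measure (M n) {\<omega> \<in> space (M n). \<bar>real n / ln (real (p n)) * T n \<omega> - - 4\<bar> > 1}"
        using large s
      proof eventually_elim
        case (elim n)
        interpret prob_space "M n" using assms(2) elim by simp
        have [measurable]: "T n \<in> borel_measurable (M n)" using T elim by simp
        have l: "ln (real (p n)) > 0" using elim by simp
        show ?case
        proof (rule finite_measure_mono)
          show "{\<omega> \<in> space (M n). \<bar>L n \<omega> - 1\<bar> > \<epsilon>} \<subseteq>
              {\<omega> \<in> space (M n). \<bar>real n / ln (real (p n)) * T n \<omega> - - 4\<bar> > 1}"
          proof clarify
            fix \<omega> assume a: "\<epsilon> < \<bar>L n \<omega> - 1\<bar>"
            have L1: "0 \<le> L n \<omega>" "L n \<omega> \<le> 1 - \<eta>" using L01[OF elim(1), of \<omega>] a \<eta> by auto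
            have "(L n \<omega>)\<^sup>2 \<le> 1 * L n \<omega>"
              unfolding power2_eq_square using L1 \<eta> by (intro mult_right_mono) auto
            then have "\<eta> \<le> 1 - (L n \<omega>)\<^sup>2" using L1 by simp
            then have "ln \<eta> \<le> T n \<omega>" unfolding T_def using \<eta> by (intro ln_mono) auto
            then have "real n / ln (real (p n)) * ln \<eta> \<le> real n / ln (real (p n)) * T n \<omega>"
              using l by (intro mult_left_mono) auto
            then show "1 < \<bar>real n / ln (real (p n)) * T n \<omega> - - 4\<bar>" using elim by linarith
          qed
        qed measurable
      qed
    qed simp
  qed

  show ?thesis
  proof (intro conjI exI[of _ "interval_measure F"])
    show "conv_in_law M (\<lambda>n \<omega>. real n * T n \<omega> + 4 * real n / (real n - 2) * ln (real (p n)) - ln (real n))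
        (interval_measure F)"
      using law unfolding W_def .
    show "\<forall>y. cdf (interval_measure F) y = 1 - exp (- K * exp (y / 2))"
      unfolding F(2) by (simp add: F_def)
  qed (use L_prob T_prob F(1) in auto)
qed

end
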